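(* Let $\varepsilon\in\{1,-1\}$, let $S$ be an orientable surface and let $\psi:S\to\mathbb{M}^2(\varepsilon)\times\mathbb{R}$ be an immersion of constant Gaussian curvature $K(I)\neq\varepsilon$, with height function $h$ and second fundamental form $II$. If the quadratic form $$A=I+\frac{1}{\varepsilon K(I)-1}\,dh^2$$ is a Riemannian metric on $S$, then $(A,II)$ is a Codazzi pair of constant extrinsic curvature.
   Context: $\mathbb{M}^2(1)=\mathbb{S}^2$ is the unit sphere (curvature $1$) and $\mathbb{M}^2(-1)=\mathbb{H}^2$ the hyperbolic plane (curvature $-1$); $\mathbb{M}^2(\varepsilon)\times\mathbb{R}$ carries the product metric. For an immersion $\psi:S\to\mathbb{M}^2(\varepsilon)\times\mathbb{R}$ with unit normal vector field $N$ (tangent to the ambient space), $I=\langle d\psi,d\psi\rangle$ and $II=\langle -dN,d\psi\rangle$ are the first and second fundamental forms, $K(I)$ is the intrinsic Gaussian curvature of $I$, and the height function $h:S\to\mathbb{R}$ is the $\mathbb{R}$-component of $\psi$. Let $(A,B)$ be a pair of real quadratic forms on $S$ with $A$ a Riemannian metric, written in local parameters $(u,v)$ as $A=E\,du^2+2F\,du\,dv+G\,dv^2$, $B=e\,du^2+2f\,du\,dv+g\,dv^2$. The extrinsic curvature of the pair is $K(A,B)=\dfrac{eg-f^2}{EG-F^2}$. The pair is a Codazzi pair if, for all local parameters, $$e_v-f_u=e\Gamma_{12}^1+f(\Gamma_{12}^2-\Gamma_{11}^1)-g\Gamma_{11}^2,\qquad f_v-g_u=e\Gamma_{22}^1+f(\Gamma_{22}^2-\Gamma_{12}^1)-g\Gamma_{12}^2,$$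 where $\Gamma_{ij}^k$ are the Christoffel symbols of the metric $A$. *)

theory Defs
  imports "HOL-Analysis.Analysis"
begin

section \<open>Smooth maps and smooth surfaces\<close>

text \<open>\<^term>\<open>f\<close> is of class C-k on the open set \<^term>\<open>U\<close>. For sets that are not open
  the definition is not meaningful, since \<^term>\<open>frechet_derivative f (at x)\<close> ignores
  \<^term>\<open>U\<close>.\<close>

primrec Ck_on ::
  "nat \<Rightarrow> ('a::euclidean_space \<Rightarrow> 'b::real_normed_vector) \<Rightarrow> 'a set \<Rightarrow> bool" where
  "Ck_on 0 f U \<longleftrightarrow> continuous_on U f"
| "Ck_on (Suc k) f U \<longleftrightarrow>
     f differentiable_on U \<and> (\<forall>v. Ck_on k (\<lambda>x. frechet_derivative f (at x) v) U)"

definition smooth_on ::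
  "('a::euclidean_space \<Rightarrow> 'b::real_normed_vector) \<Rightarrow> 'a set \<Rightarrow> bool" where
  "smooth_on f U \<longleftrightarrow> (\<forall>k. Ck_on k f U)"

definition pd :: "2 \<Rightarrow> (real^2 \<Rightarrow> 'b::real_normed_vector) \<Rightarrow> real^2 \<Rightarrow> 'b" where
  "pd i f x = frechet_derivative f (at x) (axis i 1)"

text \<open>A chart is a pair of a domain and a coordinate map; the values of the coordinate map
  outside the domain are irrelevant.\<close>

type_synonym 'a chart = "'a set \<times> ('a \<Rightarrow> real^2)"

abbreviation chart_dom :: "'a chart \<Rightarrow> 'a set" where
  "chart_dom c \<equiv> fst c"

abbreviation chart_range :: "'a chart \<Rightarrow> (real^2) set" where
  "chart_range c \<equiv> snd c ` fst c"

definition is_chart :: "'a topology \<Rightarrow> 'a chart \<Rightarrow> bool" where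
  "is_chart X c \<longleftrightarrow>
     openin X (chart_dom c) \<and> open (chart_range c) \<and>
     homeomorphic_map (subtopology X (chart_dom c)) (top_of_set (chart_range c)) (snd c)"

definition local_expr :: "('a \<Rightarrow> 'b) \<Rightarrow> 'a chart \<Rightarrow> real^2 \<Rightarrow> 'b" where
  "local_expr f c = f \<circ> inv_into (fst c) (snd c)"

definition transition :: "'a chart \<Rightarrow> 'a chart \<Rightarrow> real^2 \<Rightarrow> real^2" where
  "transition c d = local_expr (snd d) c"

definition overlap :: "'a chart \<Rightarrow> 'a chart \<Rightarrow> (real^2) set" where
  "overlap c d = snd c ` (chart_dom c \<inter> chart_dom d)"

definition compatible :: "'a chart \<Rightarrow> 'a chart \<Rightarrow> bool" where
  "compatible c d \<longleftrightarrow>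
     smooth_on (transition c d) (overlap c d) \<and> smooth_on (transition d c) (overlap d c)"

text \<open>The smooth structure is a maximal atlas, so that quantifying over its charts is
  quantifying over all local parameters. Connectedness is not required.\<close>

definition smooth_surface :: "'a topology \<Rightarrow> 'a chart set \<Rightarrow> bool" where
  "smooth_surface X \<A> \<longleftrightarrow>
     Hausdorff_space X \<and>
     (\<exists>\<B>. countable \<B> \<and> (\<forall>B\<in>\<B>. openin X B) \<and>
          (\<forall>U p. openin X U \<and> p \<in> U \<longrightarrow> (\<exists>B\<in>\<B>. p \<in> B \<and> B \<subseteq> U))) \<and>
     (\<forall>c\<in>\<A>. is_chart X c) \<and>
     (\<Union>c\<in>\<A>. chart_dom c) = topspace X \<and>
     (\<forall>c\<in>\<A>. \<forall>d\<in>\<A>. compatible c d) \<and>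
     (\<forall>c. is_chart X c \<and> (\<forall>d\<in>\<A>. compatible c d) \<longrightarrow> c \<in> \<A>)"

definition orientable :: "'a topology \<Rightarrow> 'a chart set \<Rightarrow> bool" where
  "orientable X \<A> \<longleftrightarrow>
     (\<exists>\<O>\<subseteq>\<A>. (\<Union>c\<in>\<O>. chart_dom c) = topspace X \<and>
        (\<forall>c\<in>\<O>. \<forall>d\<in>\<O>. \<forall>x\<in>overlap c d. det (jacobian (transition c d) (at x)) > 0))"

definition smooth_map :: "'a chart set \<Rightarrow> ('a \<Rightarrow> 'b::real_normed_vector) \<Rightarrow> bool" where
  "smooth_map \<A> f \<longleftrightarrow> (\<forall>c\<in>\<A>. smooth_on (local_expr f c) (chart_range c))"


section \<open>Quadratic forms on a surface\<close>

text \<open>A quadratic form on a surface is given by its symmetric coefficient matrix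
  (E, F; F, G) in every chart, as a function of the local parameters, subject to the
  transformation law under changes of chart.\<close>

type_synonym 'a form = "'a chart \<Rightarrow> real^2 \<Rightarrow> real^2^2"

definition quadratic_form :: "'a chart set \<Rightarrow> 'a form \<Rightarrow> bool" where
  "quadratic_form \<A> Q \<longleftrightarrow>
     (\<forall>c\<in>\<A>. smooth_on (Q c) (chart_range c)) \<and>
     (\<forall>c\<in>\<A>. \<forall>x\<in>chart_range c. transpose (Q c x) = Q c x) \<and>
     (\<forall>c\<in>\<A>. \<forall>d\<in>\<A>. \<forall>x\<in>overlap c d.
        let J = jacobian (transition c d) (at x)
        in Q c x = transpose J ** Q d (transition c d x) ** J)"

definition riemannian_metric :: "'a chart set \<Rightarrow> 'a form \<Rightarrow> bool" where
  "riemannian_metric \<A> A \<longleftrightarrow>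
     quadratic_form \<A> A \<and>
     (\<forall>c\<in>\<A>. \<forall>x\<in>chart_range c. \<forall>v. v \<noteq> 0 \<longrightarrow> v \<bullet> (A c x *v v) > 0)"

text \<open>\<^term>\<open>christoffel A i j k\<close> has lower indices \<^term>\<open>i\<close>, \<^term>\<open>j\<close> and upper index
  \<^term>\<open>k\<close>.\<close>

definition christoffel :: "(real^2 \<Rightarrow> real^2^2) \<Rightarrow> 2 \<Rightarrow> 2 \<Rightarrow> 2 \<Rightarrow> real^2 \<Rightarrow> real" where
  "christoffel A i j k x =
     1/2 * (\<Sum>l\<in>UNIV. matrix_inv (A x) $ k $ l *
       (pd i (\<lambda>y. A y $ j $ l) x + pd j (\<lambda>y. A y $ i $ l) x - pd l (\<lambda>y. A y $ i $ j) x))"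

text \<open>Intrinsic Gaussian curvature: the component R(d1,d2)d2 . d1 of the curvature tensor of the
  Levi-Civita connection, divided by the determinant of the metric, where
  R(X,Y)Z = D_X D_Y Z - D_Y D_X Z - D_[X,Y] Z (so the unit sphere has curvature 1).\<close>

definition gauss_curvature :: "(real^2 \<Rightarrow> real^2^2) \<Rightarrow> real^2 \<Rightarrow> real" where
  "gauss_curvature A x =
     (\<Sum>m\<in>UNIV. A x $ m $ 1 *
        (pd 1 (christoffel A 2 2 m) x - pd 2 (christoffel A 1 2 m) x
         + (\<Sum>l\<in>UNIV. christoffel A 2 2 l x * christoffel A 1 l m x
                     - christoffel A 1 2 l x * christoffel A 2 l m x)))
     / det (A x)"

definition extrinsic_curvature ::
  "(real^2 \<Rightarrow> real^2^2) \<Rightarrow> (real^2 \<Rightarrow> real^2^2) \<Rightarrow> real^2 \<Rightarrow> real" where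
  "extrinsic_curvature A B x =
     (B x $ 1 $ 1 * B x $ 2 $ 2 - (B x $ 1 $ 2)\<^sup>2) / (A x $ 1 $ 1 * A x $ 2 $ 2 - (A x $ 1 $ 2)\<^sup>2)"

definition codazzi_equations ::
  "(real^2 \<Rightarrow> real^2^2) \<Rightarrow> (real^2 \<Rightarrow> real^2^2) \<Rightarrow> real^2 \<Rightarrow> bool" where
  "codazzi_equations A B x \<longleftrightarrow>
     (let e = (\<lambda>y. B y $ 1 $ 1); f = (\<lambda>y. B y $ 1 $ 2); g = (\<lambda>y. B y $ 2 $ 2);
          \<Gamma> = (\<lambda>i j k. christoffel A i j k x)
      in pd 2 e x - pd 1 f x = e x * \<Gamma> 1 2 1 + f x * (\<Gamma> 1 2 2 - \<Gamma> 1 1 1) - g x * \<Gamma> 1 1 2 \<and>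
         pd 2 f x - pd 1 g x = e x * \<Gamma> 2 2 1 + f x * (\<Gamma> 2 2 2 - \<Gamma> 1 2 1) - g x * \<Gamma> 1 2 2)"

definition codazzi_pair :: "'a chart set \<Rightarrow> 'a form \<Rightarrow> 'a form \<Rightarrow> bool" where
  "codazzi_pair \<A> A B \<longleftrightarrow>
     riemannian_metric \<A> A \<and> quadratic_form \<A> B \<and>
     (\<forall>c\<in>\<A>. \<forall>x\<in>chart_range c. codazzi_equations (A c) (B c) x)"

definition constant_gauss_curvature :: "'a chart set \<Rightarrow> 'a form \<Rightarrow> real \<Rightarrow> bool" where
  "constant_gauss_curvature \<A> A k \<longleftrightarrow>
     (\<forall>c\<in>\<A>. \<forall>x\<in>chart_range c. gauss_curvature (A c) x = k)"

definition constant_extrinsic_curvature ::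
  "'a chart set \<Rightarrow> 'a form \<Rightarrow> 'a form \<Rightarrow> real \<Rightarrow> bool" where
  "constant_extrinsic_curvature \<A> A B \<kappa> \<longleftrightarrow>
     (\<forall>c\<in>\<A>. \<forall>x\<in>chart_range c. extrinsic_curvature (A c) (B c) x = \<kappa>)"


section \<open>Surfaces immersed in M2(eps) x R\<close>

text \<open>M2(1) is the unit sphere of Euclidean 3-space and M2(-1) the hyperboloid model of the
  hyperbolic plane in Minkowski 3-space. The product with the real line carries the metric
  induced by \<^term>\<open>amb_inner \<epsilon>\<close>, which is positive definite on its tangent spaces.\<close>

definition M2_inner :: "real \<Rightarrow> real^3 \<Rightarrow> real^3 \<Rightarrow> real" where
  "M2_inner \<epsilon> x y = x $ 1 * y $ 1 + x $ 2 * y $ 2 + \<epsilon> * x $ 3 * y $ 3"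

definition M2 :: "real \<Rightarrow> (real^3) set" where
  "M2 \<epsilon> = {x. M2_inner \<epsilon> x x = \<epsilon> \<and> (\<epsilon> = -1 \<longrightarrow> x $ 3 > 0)}"

definition amb_inner :: "real \<Rightarrow> (real^3) \<times> real \<Rightarrow> (real^3) \<times> real \<Rightarrow> real" where
  "amb_inner \<epsilon> p q = M2_inner \<epsilon> (fst p) (fst q) + snd p * snd q"

definition immersion ::
  "real \<Rightarrow> 'a topology \<Rightarrow> 'a chart set \<Rightarrow> ('a \<Rightarrow> (real^3) \<times> real) \<Rightarrow> bool" where
  "immersion \<epsilon> X \<A> \<psi> \<longleftrightarrow>
     \<psi> ` topspace X \<subseteq> M2 \<epsilon> \<times> UNIV \<and> smooth_map \<A> \<psi> \<and>
     (\<forall>c\<in>\<A>. \<forall>x\<in>chart_range c. inj (frechet_derivative (local_expr \<psi> c) (at x)))"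

text \<open>The first condition on \<^term>\<open>N\<close> below says that it is tangent to M2(eps) x R; the second
  and third that it has unit length and is normal to the surface.\<close>

definition unit_normal ::
  "real \<Rightarrow> 'a topology \<Rightarrow> 'a chart set \<Rightarrow> ('a \<Rightarrow> (real^3) \<times> real) \<Rightarrow> ('a \<Rightarrow> (real^3) \<times> real) \<Rightarrow> bool" where
  "unit_normal \<epsilon> X \<A> \<psi> N \<longleftrightarrow>
     smooth_map \<A> N \<and>
     (\<forall>p\<in>topspace X. M2_inner \<epsilon> (fst (N p)) (fst (\<psi> p)) = 0) \<and>
     (\<forall>p\<in>topspace X. amb_inner \<epsilon> (N p) (N p) = 1) \<and>
     (\<forall>c\<in>\<A>. \<forall>x\<in>chart_range c. \<forall>v.
        amb_inner \<epsilon> (local_expr N c x) (frechet_derivative (local_expr \<psi> c) (at x) v) = 0)"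

definition first_form :: "real \<Rightarrow> ('a \<Rightarrow> (real^3) \<times> real) \<Rightarrow> 'a form" where
  "first_form \<epsilon> \<psi> c x =
     (\<chi> i j. amb_inner \<epsilon> (pd i (local_expr \<psi> c) x) (pd j (local_expr \<psi> c) x))"

text \<open>Here dN is the derivative of \<^term>\<open>N\<close> in the flat space containing M2(eps) x R. It differs
  from the covariant derivative in M2(eps) x R by a multiple of the normal of M2(eps), which is
  orthogonal to the image of the differential of \<^term>\<open>\<psi>\<close>.\<close>

definition second_form ::
  "real \<Rightarrow> ('a \<Rightarrow> (real^3) \<times> real) \<Rightarrow> ('a \<Rightarrow> (real^3) \<times> real) \<Rightarrow> 'a form" where
  "second_form \<epsilon> \<psi> N c x =
     (\<chi> i j. amb_inner \<epsilon> (- pd i (local_expr N c) x) (pd j (local_expr \<psi> c) x))"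

definition height :: "('a \<Rightarrow> (real^3) \<times> real) \<Rightarrow> 'a \<Rightarrow> real" where
  "height \<psi> p = snd (\<psi> p)"

definition differential_sq :: "('a \<Rightarrow> real) \<Rightarrow> 'a form" where
  "differential_sq h c x = (\<chi> i j. pd i (local_expr h c) x * pd j (local_expr h c) x)"

end

theory Submission
  imports Defs
begin

text \<open>Let \<open>c = 1 / (\<epsilon> K - 1)\<close>, so that \<open>c (K - \<epsilon>) = \<epsilon>\<close>. Let \<open>\<phi>\<close> be the component of
  \<open>\<psi>\<close> in M2(eps), \<open>\<nu>\<close> the vertical component of \<open>N\<close> and \<open>\<eta> = (\<phi>, 0)\<close>, which is normal to
  M2(eps) x R in the flat space. The Gauss formula
  \<open>\<psi>_ij = \<Gamma>_ij^k \<psi>_k + II_ij N - \<epsilon> (I_ij - h_i h_j) \<eta>\<close> yields the Gauss equation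
  \<open>K det I = det II + \<epsilon> det (I - dh^2)\<close>, and, since \<open>det (I + t dh^2)\<close> is affine in \<open>t\<close>, this
  says \<open>det II = (K - \<epsilon>) det A\<close>. It also yields the Codazzi equations of \<open>(I, II)\<close> with the error
  term \<open>- \<epsilon> \<nu> (I_1i h_2 - I_2i h_1)\<close>. The last component of the Gauss formula is
  \<open>h_ij = \<Gamma>_ij^k h_k + \<nu> II_ij\<close>, whence the Christoffel symbols of \<open>A\<close> are
  \<open>\<Gamma>_ij^k + c \<nu> II_ij w^k\<close> with \<open>w\<close> the gradient of \<open>h\<close> for \<open>A\<close>. Passing from \<open>I\<close> to \<open>A\<close>
  therefore changes the Codazzi equations by \<open>c \<nu> det II\<close> times a component of \<open>w\<close>, which is
  exactly the error term because \<open>c det II = \<epsilon> det A\<close>.\<close>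

section \<open>Calculus of C-k maps\<close>

text \<open>Two mean value theorems: first along \<open>u\<close> for the increment of
  \<open>f\<close> over the step \<open>t\<close> in direction \<open>v\<close>, then along
  \<open>v\<close> for the derivative of \<open>f\<close> in direction \<open>u\<close>. The
  intermediate point is only known to lie in the parallelogram, which suffices for a limit
  argument.\<close>

lemma second_difference_mvt:
  fixes f :: "'a::real_normed_vector \<Rightarrow> real"
  assumes "0 < t"
    and f: "\<And>r s. 0 \<le> r \<Longrightarrow> r \<le> t \<Longrightarrow> 0 \<le> s \<Longrightarrow> s \<le> t \<Longrightarrow>
          f differentiable (at (x + r *\<^sub>R u + s *\<^sub>R v))"
    and fu: "\<And>r s. 0 \<le> r \<Longrightarrow> r \<le> t \<Longrightarrow> 0 \<le> s \<Longrightarrow> s \<le> t \<Longrightarrow>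
          (\<lambda>y. frechet_derivative f (at y) u) differentiable (at (x + r *\<^sub>R u + s *\<^sub>R v))"
  shows "\<exists>r s. 0 \<le> r \<and> r \<le> t \<and> 0 \<le> s \<and> s \<le> t \<and>
     f (x + t *\<^sub>R u + t *\<^sub>R v) - f (x + t *\<^sub>R u) - f (x + t *\<^sub>R v) + f x =
     t * t * frechet_derivative (\<lambda>y. frechet_derivative f (at y) u) (at (x + r *\<^sub>R u + s *\<^sub>R v)) v"
proof -
  have line_u: "((\<lambda>r. f (x + r *\<^sub>R u + s *\<^sub>R v)) has_real_derivative
      frechet_derivative f (at (x + r *\<^sub>R u + s *\<^sub>R v)) u) (at r)"
    if "0 \<le> r" "r \<le> t" "0 \<le> s" "s \<le> t" for r s
  proof -
    have d: "(f has_derivative frechet_derivative f (at (x + r *\<^sub>R u + s *\<^sub>R v)))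
        (at (x + r *\<^sub>R u + s *\<^sub>R v))"
      using f[OF that] frechet_derivative_works by blast
    have "((\<lambda>r. x + r *\<^sub>R u + s *\<^sub>R v) has_derivative (\<lambda>h. h *\<^sub>R u)) (at r)"
      by (auto intro!: derivative_eq_intros)
    from has_derivative_compose[OF this d]
    show ?thesis
      by (simp add: has_field_derivative_def linear_cmul[OF has_derivative_linear[OF d]]
            mult_commute_abs)
  qed
  have line_v: "((\<lambda>s. frechet_derivative f (at (x + r *\<^sub>R u + s *\<^sub>R v)) u) has_real_derivative
      frechet_derivative (\<lambda>y. frechet_derivative f (at y) u) (at (x + r *\<^sub>R u + s *\<^sub>R v)) v) (at s)"
    if "0 \<le> r" "r \<le> t" "0 \<le> s" "s \<le> t" for r s
  proof -
    let ?g = "\<lambda>y. frechet_derivative f (at y) u"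
    have d: "(?g has_derivative frechet_derivative ?g (at (x + r *\<^sub>R u + s *\<^sub>R v)))
        (at (x + r *\<^sub>R u + s *\<^sub>R v))"
      using fu[OF that] frechet_derivative_works by blast
    have "((\<lambda>s. x + r *\<^sub>R u + s *\<^sub>R v) has_derivative (\<lambda>h. h *\<^sub>R v)) (at s)"
      by (auto intro!: derivative_eq_intros)
    from has_derivative_compose[OF this d]
    show ?thesis
      by (simp add: has_field_derivative_def linear_cmul[OF has_derivative_linear[OF d]]
            mult_commute_abs)
  qed
  \<comment> \<open>The term \<open>0 *\<^sub>R v\<close> is kept unsimplified, so that
    \<open>line_u\<close> matches both ends s = t and s = 0 of the increment.\<close>
  have "\<exists>r>0. r < t \<and> (f (x + t *\<^sub>R u + t *\<^sub>R v) - f (x + t *\<^sub>R u + 0 *\<^sub>R v)) -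
        (f (x + 0 *\<^sub>R u + t *\<^sub>R v) - f (x + 0 *\<^sub>R u + 0 *\<^sub>R v)) =
      (t - 0) * (frechet_derivative f (at (x + r *\<^sub>R u + t *\<^sub>R v)) u -
         frechet_derivative f (at (x + r *\<^sub>R u + 0 *\<^sub>R v)) u)"
    by (rule MVT2[where f="\<lambda>r. f (x + r *\<^sub>R u + t *\<^sub>R v) - f (x + r *\<^sub>R u + 0 *\<^sub>R v)"])
      (use assms(1) in \<open>auto intro!: DERIV_diff line_u simp del: scaleR_zero_left\<close>)
  then obtain r where r: "0 < r" "r < t"
    "f (x + t *\<^sub>R u + t *\<^sub>R v) - f (x + t *\<^sub>R u) - f (x + t *\<^sub>R v) + f x =
      t * (frechet_derivative f (at (x + r *\<^sub>R u + t *\<^sub>R v)) u -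
         frechet_derivative f (at (x + r *\<^sub>R u + 0 *\<^sub>R v)) u)"
    by auto
  have "\<exists>s>0. s < t \<and> frechet_derivative f (at (x + r *\<^sub>R u + t *\<^sub>R v)) u -
         frechet_derivative f (at (x + r *\<^sub>R u + 0 *\<^sub>R v)) u =
      (t - 0) * frechet_derivative (\<lambda>y. frechet_derivative f (at y) u) (at (x + r *\<^sub>R u + s *\<^sub>R v)) v"
    by (rule MVT2) (use assms(1) r in \<open>auto intro!: line_v simp del: scaleR_zero_left\<close>)
  then obtain s where "0 < s" "s < t"
    "frechet_derivative f (at (x + r *\<^sub>R u + t *\<^sub>R v)) u -
         frechet_derivative f (at (x + r *\<^sub>R u + 0 *\<^sub>R v)) u =
      t * frechet_derivative (\<lambda>y. frechet_derivative f (at y) u) (at (x + r *\<^sub>R u + s *\<^sub>R v)) v"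
    by auto
  with r show ?thesis
    by (intro exI[of _ r] exI[of _ s]) (auto simp: algebra_simps)
qed

lemma Ck_on_differentiable:
  assumes "Ck_on (Suc k) f U" "open U" "x \<in> U"
  shows "f differentiable (at x)"
  using assms by (simp add: differentiable_on_eq_differentiable_at)

text \<open>The second difference is symmetric in \<open>u\<close> and \<open>v\<close>, so the mean
  value lemma in both orders equates the two mixed derivatives at two points close to
  \<open>x\<close>. Continuity of the mixed derivatives carries the equality to \<open>x\<close> up
  to any \<open>e\<close>.\<close>

lemma second_derivative_symmetric_real:
  fixes f :: "'a::euclidean_space \<Rightarrow> real"
  assumes "open U" "x \<in> U" and C2: "Ck_on 2 f U"
  shows "frechet_derivative (\<lambda>y. frechet_derivative f (at y) u) (at x) v =
         frechet_derivative (\<lambda>y. frechet_derivative f (at y) v) (at x) u"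
proof -
  define D where "D u v y = frechet_derivative (\<lambda>y. frechet_derivative f (at y) u) (at y) v" for u v y
  have f: "f differentiable (at y)"
    and fu: "(\<lambda>y. frechet_derivative f (at y) w) differentiable (at y)"
    and D: "isCont (D w z) y" if "y \<in> U" for y w z
    using C2 that assms(1) unfolding D_def
    by (auto simp: numeral_2_eq_2 differentiable_on_eq_differentiable_at continuous_on_eq_continuous_at)
  have bound: "\<bar>D u v x - D v u x\<bar> \<le> e" if "e > 0" for e
  proof -
    have half: "e/2 > 0" using that by simp
    obtain d1 where d1: "d1 > 0" "\<And>y. dist y x < d1 \<Longrightarrow> dist (D u v y) (D u v x) < e/2"
      using D[OF assms(2), of u v, unfolded continuous_at_eps_delta, rule_format, OF half]
      by blast
    obtain d2 where d2: "d2 > 0" "\<And>y. dist y x < d2 \<Longrightarrow> dist (D v u y) (D v u x) < e/2"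
      using D[OF assms(2), of v u, unfolded continuous_at_eps_delta, rule_format, OF half]
      by blast
    obtain d3 where d3: "d3 > 0" "ball x d3 \<subseteq> U"
      using assms openE by blast
    define d where "d = min d1 (min d2 d3)"
    \<comment> \<open>The summand 1 keeps \<open>n\<close> positive even if \<open>u\<close> and
      \<open>v\<close> vanish. With this \<open>t\<close> every point of the parallelogram is within
      t n = d / 2 of \<open>x\<close>, hence inside all three neighbourhoods.\<close>
    define n where "n = norm u + norm v + 1"
    define t where "t = d / (2 * n)"
    have den: "n > 0"
      using norm_ge_zero[of u] norm_ge_zero[of v] unfolding n_def by linarith
    have "d > 0" using d1 d2 d3 by (simp add: d_def)
    then have "t > 0" using den by (simp add: t_def)
    have near: "dist (x + r *\<^sub>R u + s *\<^sub>R v) x < d" if "0 \<le> r" "r \<le> t" "0 \<le> s" "s \<le> t" for r s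
    proof -
      have "dist (x + r *\<^sub>R u + s *\<^sub>R v) x = norm (r *\<^sub>R u + s *\<^sub>R v)"
        by (simp add: dist_norm)
      also have "\<dots> \<le> r * norm u + s * norm v"
        using norm_triangle_ineq[of "r *\<^sub>R u" "s *\<^sub>R v"] that by simp
      also have "\<dots> \<le> t * norm u + t * norm v"
        using that by (intro add_mono mult_right_mono) auto
      also have "\<dots> \<le> t * n"
        using \<open>t > 0\<close> by (simp add: n_def algebra_simps)
      also have "\<dots> = d / 2" using den by (simp add: t_def)
      also have "\<dots> < d" using \<open>d > 0\<close> by simp
      finally show ?thesis .
    qed
    have inU: "x + r *\<^sub>R u + s *\<^sub>R v \<in> U" if "0 \<le> r" "r \<le> t" "0 \<le> s" "s \<le> t" for r s
      using near[OF that] d3 by (auto simp: d_def subset_iff dist_commute)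
    have inU': "x + r *\<^sub>R v + s *\<^sub>R u \<in> U" if "0 \<le> r" "r \<le> t" "0 \<le> s" "s \<le> t" for r s
      using inU[of s r] that by (simp add: ac_simps)
    obtain r s where rs: "0 \<le> r" "r \<le> t" "0 \<le> s" "s \<le> t"
      "f (x + t *\<^sub>R u + t *\<^sub>R v) - f (x + t *\<^sub>R u) - f (x + t *\<^sub>R v) + f x =
        t * t * D u v (x + r *\<^sub>R u + s *\<^sub>R v)"
      using second_difference_mvt[OF \<open>t > 0\<close> f[OF inU] fu[OF inU]] unfolding D_def by blast
    obtain r' s' where rs': "0 \<le> r'" "r' \<le> t" "0 \<le> s'" "s' \<le> t"
      "f (x + t *\<^sub>R v + t *\<^sub>R u) - f (x + t *\<^sub>R v) - f (x + t *\<^sub>R u) + f x =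
        t * t * D v u (x + r' *\<^sub>R v + s' *\<^sub>R u)"
      using second_difference_mvt[OF \<open>t > 0\<close> f[OF inU'] fu[OF inU']] unfolding D_def by blast
    have swap: "x + t *\<^sub>R v + t *\<^sub>R u = x + t *\<^sub>R u + t *\<^sub>R v" by simp
    have "t * t * D u v (x + r *\<^sub>R u + s *\<^sub>R v) =
        t * t * D v u (x + r' *\<^sub>R v + s' *\<^sub>R u)"
      using rs(5) rs'(5)[unfolded swap] by linarith
    with \<open>t > 0\<close> have "D u v (x + r *\<^sub>R u + s *\<^sub>R v) = D v u (x + s' *\<^sub>R u + r' *\<^sub>R v)"
      by (simp add: ac_simps)
    moreover have "dist (D u v (x + r *\<^sub>R u + s *\<^sub>R v)) (D u v x) < e/2"
      using near[OF rs(1-4)] by (intro d1(2)) (simp add: d_def)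
    moreover have "dist (D v u (x + s' *\<^sub>R u + r' *\<^sub>R v)) (D v u x) < e/2"
      using near[OF rs'(3,4,1,2)] by (intro d2(2)) (simp add: d_def)
    ultimately show ?thesis unfolding dist_real_def by linarith
  qed
  have "\<bar>D u v x - D v u x\<bar> \<le> 0"
    by (rule field_le_epsilon) (simp only: add_0_left bound)
  then show ?thesis by (simp add: D_def)
qed

section \<open>Locality of derivatives; closure of C-k maps under linear and bilinear
  operations\<close>

lemma frechet_derivative_eq_on:
  assumes "open U" "x \<in> U" "\<And>y. y \<in> U \<Longrightarrow> f y = g y"
  shows "frechet_derivative f (at x) = frechet_derivative g (at x)"
proof -
  \<comment> \<open>\<open>frechet_derivative\<close> chooses a \<open>D\<close> satisfying this
    predicate, so equality of the predicates gives equality of the choices, whether or not a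
    derivative exists.\<close>
  have "(f has_derivative D) (at x) \<longleftrightarrow> (g has_derivative D) (at x)" for D
    using has_derivative_transform_within_open[of f D x UNIV U g]
      has_derivative_transform_within_open[of g D x UNIV U f] assms by auto
  then show ?thesis by (simp add: frechet_derivative_def)
qed

lemma differentiable_at_eq_on:
  assumes "open U" "x \<in> U" "\<And>y. y \<in> U \<Longrightarrow> f y = g y" "f differentiable (at x)"
  shows "g differentiable (at x)"
  using assms(4) has_derivative_transform_within_open[OF _ assms(1,2), of f _ UNIV g] assms(3)
  unfolding differentiable_def by blast

text \<open>Openness of \<open>U\<close> lets equality on \<open>U\<close> pass to the derivatives,
  so the induction has to range over all pairs of maps.\<close>

lemma Ck_on_cong:
  assumes "open U" "\<And>x. x \<in> U \<Longrightarrow> f x = g x" "Ck_on k f U"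
  shows "Ck_on k g U"
  using assms(2,3)
proof (induction k arbitrary: f g)
  case 0
  then show ?case by (simp cong: continuous_on_cong)
next
  case (Suc k)
  then have "g differentiable_on U"
    using assms(1) differentiable_at_eq_on[of U _ f g]
    by (auto simp: differentiable_on_eq_differentiable_at)
  moreover have "Ck_on k (\<lambda>x. frechet_derivative g (at x) v) U" for v
  proof (rule Suc.IH)
    show "Ck_on k (\<lambda>x. frechet_derivative f (at x) v) U" using Suc.prems by simp
    show "\<And>x. x \<in> U \<Longrightarrow> frechet_derivative f (at x) v = frechet_derivative g (at x) v"
      using frechet_derivative_eq_on[OF assms(1) _ Suc.prems(1)] by simp
  qed
  ultimately show ?case by simp
qed

lemma Ck_on_SucD: "Ck_on (Suc k) f U \<Longrightarrow> Ck_on k f U"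
  by (induction k arbitrary: f) (auto simp: differentiable_imp_continuous_on)

lemma frechet_derivative_bounded_linear:
  assumes "bounded_linear L" "f differentiable (at x)"
  shows "frechet_derivative (\<lambda>y. L (f y)) (at x) v = L (frechet_derivative f (at x) v)"
    and "(\<lambda>y. L (f y)) differentiable (at x)"
proof -
  have "((\<lambda>y. L (f y)) has_derivative (\<lambda>v. L (frechet_derivative f (at x) v))) (at x)"
    by (rule bounded_linear.has_derivative[OF assms(1) frechet_derivative_works[THEN iffD1, OF assms(2)]])
  then show "frechet_derivative (\<lambda>y. L (f y)) (at x) v = L (frechet_derivative f (at x) v)"
    and "(\<lambda>y. L (f y)) differentiable (at x)"
    by (auto simp flip: frechet_derivative_at intro: differentiableI)
qed

lemma frechet_derivative_bilinear:
  assumes "bounded_bilinear B" "f differentiable (at x)" "g differentiable (at x)"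
  shows "frechet_derivative (\<lambda>y. B (f y) (g y)) (at x) v =
           B (f x) (frechet_derivative g (at x) v) + B (frechet_derivative f (at x) v) (g x)"
    and "(\<lambda>y. B (f y) (g y)) differentiable (at x)"
proof -
  have "((\<lambda>y. B (f y) (g y)) has_derivative (\<lambda>v. B (f x) (frechet_derivative g (at x) v)
      + B (frechet_derivative f (at x) v) (g x))) (at x)"
    by (rule bounded_bilinear.FDERIV) (use assms in \<open>simp_all add: frechet_derivative_works\<close>)
  then show "frechet_derivative (\<lambda>y. B (f y) (g y)) (at x) v =
           B (f x) (frechet_derivative g (at x) v) + B (frechet_derivative f (at x) v) (g x)"
    and "(\<lambda>y. B (f y) (g y)) differentiable (at x)"
    by (auto simp flip: frechet_derivative_at intro: differentiableI)
qed

lemma frechet_derivative_plus: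
  assumes "f differentiable (at x)" "g differentiable (at x)"
  shows "frechet_derivative (\<lambda>y. f y + g y) (at x) v =
           frechet_derivative f (at x) v + frechet_derivative g (at x) v"
proof -
  have "((\<lambda>y. f y + g y) has_derivative (\<lambda>v. frechet_derivative f (at x) v
      + frechet_derivative g (at x) v)) (at x)"
    using assms by (intro has_derivative_add) (simp_all add: frechet_derivative_works)
  then show ?thesis by (simp flip: frechet_derivative_at)
qed

lemma Ck_on_bounded_linear:
  assumes L: "bounded_linear L" and "open U" "Ck_on k f U"
  shows "Ck_on k (\<lambda>x. L (f x)) U"
  using assms(3)
proof (induction k arbitrary: f)
  case 0
  then show ?case by (simp add: bounded_linear.continuous_on[OF L])
next
  case (Suc k)
  have d: "f differentiable (at x)" if "x \<in> U" for x
    using Ck_on_differentiable[OF Suc.prems assms(2) that] .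
  have "Ck_on k (\<lambda>x. frechet_derivative (\<lambda>y. L (f y)) (at x) v) U" for v
    by (rule Ck_on_cong[OF assms(2) _ Suc.IH[of "\<lambda>x. frechet_derivative f (at x) v"]])
      (use Suc.prems in \<open>simp_all add: frechet_derivative_bounded_linear[OF L d]\<close>)
  then show ?case
    using frechet_derivative_bounded_linear(2)[OF L d] assms(2)
    by (simp add: differentiable_on_eq_differentiable_at)
qed

lemma Ck_on_plus:
  assumes "open U" "Ck_on k f U" "Ck_on k g U"
  shows "Ck_on k (\<lambda>x. f x + g x) U"
  using assms(2,3)
proof (induction k arbitrary: f g)
  case 0
  then show ?case by (simp add: continuous_on_add)
next
  case (Suc k)
  have d: "f differentiable (at x)" "g differentiable (at x)" if "x \<in> U" for x
    using Suc.prems assms(1) that by (auto intro: Ck_on_differentiable)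
  have "Ck_on k (\<lambda>x. frechet_derivative (\<lambda>y. f y + g y) (at x) v) U" for v
    by (rule Ck_on_cong[OF assms(1) _ Suc.IH[of "\<lambda>x. frechet_derivative f (at x) v"
          "\<lambda>x. frechet_derivative g (at x) v"]])
      (use Suc.prems in \<open>simp_all add: frechet_derivative_plus d\<close>)
  then show ?case
    using d assms(1) by (simp add: differentiable_on_eq_differentiable_at)
qed

text \<open>The Leibniz rule gives two terms of the same shape with one factor differentiated. The
  induction hypothesis, general in both factors, applies to each once the other factor is lowered by
  one order.\<close>

lemma Ck_on_bilinear:
  assumes B: "bounded_bilinear B" and "open U" "Ck_on k f U" "Ck_on k g U"
  shows "Ck_on k (\<lambda>x. B (f x) (g x)) U"
  using assms(3,4)
proof (induction k arbitrary: f g)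
  case 0
  then show ?case by (simp add: bounded_bilinear.continuous_on[OF B])
next
  case (Suc k)
  have d: "f differentiable (at x)" "g differentiable (at x)" if "x \<in> U" for x
    using Suc.prems assms(2) that by (auto intro: Ck_on_differentiable)
  have "Ck_on k (\<lambda>x. frechet_derivative (\<lambda>y. B (f y) (g y)) (at x) v) U" for v
  proof (rule Ck_on_cong[OF assms(2)])
    show "Ck_on k (\<lambda>x. B (f x) (frechet_derivative g (at x) v)
        + B (frechet_derivative f (at x) v) (g x)) U"
      using Suc.prems(1,2)[THEN Ck_on_SucD] Suc.prems assms(2)
      by (intro Ck_on_plus Suc.IH) simp_all
  qed (simp add: frechet_derivative_bilinear[OF B d])
  then show ?case
    using frechet_derivative_bilinear(2)[OF B d] assms(2)
    by (simp add: differentiable_on_eq_differentiable_at)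
qed

text \<open>Taking the coordinate along a basis vector commutes with both differentiations, which
  reduces the claim to real-valued maps.\<close>

lemma second_derivative_symmetric:
  fixes f :: "'a::euclidean_space \<Rightarrow> 'b::euclidean_space"
  assumes "open U" "x \<in> U" and C2: "Ck_on 2 f U"
  shows "frechet_derivative (\<lambda>y. frechet_derivative f (at y) u) (at x) v =
         frechet_derivative (\<lambda>y. frechet_derivative f (at y) v) (at x) u"
proof (rule euclidean_eqI)
  fix b :: 'b assume "b \<in> Basis"
  have L: "bounded_linear (\<lambda>z::'b. z \<bullet> b)" by (rule bounded_linear_inner_left)
  have f: "f differentiable (at y)"
    and fu: "(\<lambda>y. frechet_derivative f (at y) w) differentiable (at y)" if "y \<in> U" for y w
    using C2 that assms(1)
    by (auto simp: numeral_2_eq_2 differentiable_on_eq_differentiable_at)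
  have "frechet_derivative (\<lambda>y. frechet_derivative (\<lambda>y. f y \<bullet> b) (at y) w) (at x) z =
      frechet_derivative (\<lambda>y. frechet_derivative f (at y) w) (at x) z \<bullet> b" for w z
  proof -
    have "frechet_derivative (\<lambda>y. frechet_derivative (\<lambda>y. f y \<bullet> b) (at y) w) (at x) =
        frechet_derivative (\<lambda>y. frechet_derivative f (at y) w \<bullet> b) (at x)"
      by (rule frechet_derivative_eq_on[OF assms(1,2)])
        (rule frechet_derivative_bounded_linear(1)[OF L f])
    then show ?thesis
      using frechet_derivative_bounded_linear(1)[OF L fu[OF assms(2)]] by simp
  qed
  then show "frechet_derivative (\<lambda>y. frechet_derivative f (at y) u) (at x) v \<bullet> b =
      frechet_derivative (\<lambda>y. frechet_derivative f (at y) v) (at x) u \<bullet> b"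
    using second_derivative_symmetric_real[OF assms(1,2), of "\<lambda>y. f y \<bullet> b" u v]
      Ck_on_bounded_linear[OF L assms(1) C2] by simp
qed

lemma smooth_on_plus: "open U \<Longrightarrow> smooth_on f U \<Longrightarrow> smooth_on g U \<Longrightarrow> smooth_on (\<lambda>x. f x + g x) U"
  unfolding smooth_on_def using Ck_on_plus by blast

lemma smooth_on_bounded_linear:
  "bounded_linear L \<Longrightarrow> open U \<Longrightarrow> smooth_on f U \<Longrightarrow> smooth_on (\<lambda>x. L (f x)) U"
  unfolding smooth_on_def using Ck_on_bounded_linear by blast

lemma smooth_on_bilinear:
  "bounded_bilinear B \<Longrightarrow> open U \<Longrightarrow> smooth_on f U \<Longrightarrow> smooth_on g U \<Longrightarrow> smooth_on (\<lambda>x. B (f x) (g x)) U"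
  unfolding smooth_on_def using Ck_on_bilinear by blast

lemma smooth_on_pd: "smooth_on f U \<Longrightarrow> smooth_on (pd i f) U"
  unfolding smooth_on_def pd_def[abs_def] by (metis Ck_on.simps(2))

lemma smooth_on_differentiable: "smooth_on f U \<Longrightarrow> open U \<Longrightarrow> x \<in> U \<Longrightarrow> f differentiable (at x)"
  unfolding smooth_on_def using Ck_on_differentiable by blast

section \<open>Partial derivatives of maps on the plane\<close>

lemma pd_eq_on:
  "open U \<Longrightarrow> x \<in> U \<Longrightarrow> (\<And>y. y \<in> U \<Longrightarrow> f y = g y) \<Longrightarrow> pd i f x = pd i g x"
  unfolding pd_def using frechet_derivative_eq_on by metis

lemma pd_bounded_linear:
  "bounded_linear L \<Longrightarrow> f differentiable (at x) \<Longrightarrow> pd i (\<lambda>y. L (f y)) x = L (pd i f x)"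
  unfolding pd_def by (rule frechet_derivative_bounded_linear)

lemma pd_bilinear:
  "bounded_bilinear B \<Longrightarrow> f differentiable (at x) \<Longrightarrow> g differentiable (at x) \<Longrightarrow>
   pd i (\<lambda>y. B (f y) (g y)) x = B (f x) (pd i g x) + B (pd i f x) (g x)"
  unfolding pd_def by (rule frechet_derivative_bilinear)

lemma pd_plus:
  "f differentiable (at x) \<Longrightarrow> g differentiable (at x) \<Longrightarrow>
   pd i (\<lambda>y. f y + g y) x = pd i f x + pd i g x"
  unfolding pd_def by (rule frechet_derivative_plus)

lemma pd_const: "pd i (\<lambda>y. c) x = 0"
  by (simp add: pd_def)

lemma pd_commute:
  fixes f :: "real^2 \<Rightarrow> 'b::euclidean_space"
  assumes "smooth_on f U" "open U" "x \<in> U"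
  shows "pd i (pd j f) x = pd j (pd i f) x"
  using assms second_derivative_symmetric[of U x f "axis j 1" "axis i 1"]
  unfolding smooth_on_def pd_def[abs_def] by blast

lemma frechet_derivative_pd:
  fixes f :: "real^2 \<Rightarrow> 'b::real_normed_vector"
  assumes "f differentiable (at x)"
  shows "frechet_derivative f (at x) v = (v$1) *\<^sub>R pd 1 f x + (v$2) *\<^sub>R pd 2 f x"
proof -
  have "linear (frechet_derivative f (at x))"
    using assms frechet_derivative_works has_derivative_linear by blast
  then have "frechet_derivative f (at x) ((v$1) *\<^sub>R axis 1 1 + (v$2) *\<^sub>R axis 2 1) =
      (v$1) *\<^sub>R pd 1 f x + (v$2) *\<^sub>R pd 2 f x"
    by (simp add: pd_def linear_add linear_cmul)
  moreover have "(v$1) *\<^sub>R axis 1 1 + (v$2) *\<^sub>R axis 2 1 = v"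
    by (simp add: vec_eq_iff forall_2 axis_def)
  ultimately show ?thesis by simp
qed

section \<open>Linear algebra\<close>

lemma M2_inner_commute: "M2_inner \<epsilon> x y = M2_inner \<epsilon> y x"
  by (simp add: M2_inner_def)

lemma amb_inner_commute: "amb_inner \<epsilon> p q = amb_inner \<epsilon> q p"
  by (simp add: amb_inner_def M2_inner_def)

lemma amb_inner_simps:
  "amb_inner \<epsilon> (p + p') q = amb_inner \<epsilon> p q + amb_inner \<epsilon> p' q"
  "amb_inner \<epsilon> q (p + p') = amb_inner \<epsilon> q p + amb_inner \<epsilon> q p'"
  "amb_inner \<epsilon> (p - p') q = amb_inner \<epsilon> p q - amb_inner \<epsilon> p' q"
  "amb_inner \<epsilon> q (p - p') = amb_inner \<epsilon> q p - amb_inner \<epsilon> q p'"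
  "amb_inner \<epsilon> (- p) q = - amb_inner \<epsilon> p q"
  "amb_inner \<epsilon> q (- p) = - amb_inner \<epsilon> q p"
  "amb_inner \<epsilon> (a *\<^sub>R p) q = a * amb_inner \<epsilon> p q"
  "amb_inner \<epsilon> q (a *\<^sub>R p) = a * amb_inner \<epsilon> q p"
  "amb_inner \<epsilon> 0 q = 0"
  by (simp_all add: amb_inner_def M2_inner_def algebra_simps)

text \<open>Boundedness is automatic in finite dimension. It makes the Leibniz rule available for
  the ambient form, although this is indefinite on the flat space when \<epsilon> = -1.\<close>

lemma bounded_bilinear_amb_inner: "bounded_bilinear (amb_inner \<epsilon>)"
  unfolding bilinear_conv_bounded_bilinear[symmetric] bilinear_def
  by (intro conjI allI linearI) (simp_all add: amb_inner_simps)

text \<open>For \<open>\<epsilon> = -1\<close> this is the reverse Cauchy-Schwarz inequality of Minkowski space.\<close>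

lemma amb_inner_tangent_pos:
  assumes "\<epsilon> = 1 \<or> \<epsilon> = -1" "M2_inner \<epsilon> x x = \<epsilon>" "M2_inner \<epsilon> (fst V) x = 0" "V \<noteq> 0"
  shows "amb_inner \<epsilon> V V > 0"
proof -
  obtain a b c t where V: "fst V $ 1 = a" "fst V $ 2 = b" "fst V $ 3 = c" "snd V = t" by blast
  have nz: "a \<noteq> 0 \<or> b \<noteq> 0 \<or> c \<noteq> 0 \<or> t \<noteq> 0"
    using assms(4) V by (auto simp: prod_eq_iff vec_eq_iff forall_3)
  have q: "amb_inner \<epsilon> V V = a*a + b*b + \<epsilon> * c * c + t * t"
    by (simp add: amb_inner_def M2_inner_def V)
  from assms(1) show ?thesis
  proof
    assume "\<epsilon> = 1"
    moreover have "a*a + b*b + c * c + t * t > 0"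
      using nz by (smt (verit) mult_eq_0_iff not_real_square_gt_zero zero_le_square)
    ultimately show ?thesis unfolding q by simp
  next
    assume e: "\<epsilon> = -1"
    obtain x1 x2 x3 where x: "x $ 1 = x1" "x $ 2 = x2" "x $ 3 = x3" by blast
    have 1: "x3*x3 = 1 + x1*x1 + x2*x2" and 2: "c * x3 = a * x1 + b * x2"
      using assms(2,3) by (auto simp: M2_inner_def e x V)
    have "c * c * (x3 * x3) = (a * x1 + b * x2) * (a * x1 + b * x2)"
      using 2 by (metis mult.assoc mult.left_commute)
    \<comment> \<open>Lagrange's identity, with x1^2 + x2^2 replaced by x3^2 - 1; dropping the
      second square bounds c^2 x3^2 from above.\<close>
    moreover have "(a * x1 + b * x2) * (a * x1 + b * x2) + (a * x2 - b * x1) * (a * x2 - b * x1)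
        = (a*a + b*b) * (x3 * x3 - 1)"
      by (simp add: 1 algebra_simps)
    ultimately have ge: "(a*a + b*b - c*c) * (x3*x3) \<ge> a*a + b*b"
      using zero_le_square[of "a * x2 - b * x1"] by (simp add: algebra_simps)
    have x3: "x3*x3 \<ge> 1" by (simp add: 1)
    have "a*a + b*b - c*c \<ge> 0"
      using ge x3 zero_le_square[of a] zero_le_square[of b]
      by (smt (verit) mult_nonneg_nonneg mult_neg_pos)
    moreover have "a*a + b*b - c*c = 0 \<Longrightarrow> a = 0 \<and> b = 0 \<and> c = 0"
      using ge sum_squares_le_zero_iff[of a b] by auto
    ultimately have "a*a + b*b - c*c + t*t > 0"
      using nz zero_le_square[of t] by (smt (verit) not_real_square_gt_zero)
    then show ?thesis using q unfolding e by simp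
  qed
qed

text \<open>The Gram determinant makes \<open>p\<close>, \<open>q\<close>, \<open>n\<close>,
  \<open>e\<close> independent, and four is the dimension of the flat space. Pairing with
  \<open>n\<close> and \<open>e\<close> reads off the last two coefficients; the factor \<epsilon>
  comes from <e,e> = \<epsilon> and \<epsilon>^2 = 1. The tangential coefficients are identified in
  \<open>gauss_formula\<close>.\<close>

lemma frame_decomposition:
  assumes "\<epsilon> = 1 \<or> \<epsilon> = -1"
    and "amb_inner \<epsilon> e e = \<epsilon>" "amb_inner \<epsilon> n n = 1" "amb_inner \<epsilon> n e = 0"
    and "amb_inner \<epsilon> p e = 0" "amb_inner \<epsilon> q e = 0" "amb_inner \<epsilon> p n = 0" "amb_inner \<epsilon> q n = 0"
    and D: "amb_inner \<epsilon> p p * amb_inner \<epsilon> q q - amb_inner \<epsilon> p q * amb_inner \<epsilon> p q \<noteq> 0"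
  obtains a b where
    "V = a *\<^sub>R p + b *\<^sub>R q + amb_inner \<epsilon> V n *\<^sub>R n + (\<epsilon> * amb_inner \<epsilon> V e) *\<^sub>R e"
proof -
  \<comment> \<open>The domain of \<open>L\<close> is just a space of four coefficients, chosen
    equal to the codomain so that injectivity implies surjectivity.\<close>
  define L :: "(real^3) \<times> real \<Rightarrow> (real^3) \<times> real" where
    "L z = (fst z $ 1) *\<^sub>R p + (fst z $ 2) *\<^sub>R q + (fst z $ 3) *\<^sub>R n + snd z *\<^sub>R e" for z
  have lin: "linear L"
    by (rule linearI) (simp_all add: L_def algebra_simps)
  have sym: "amb_inner \<epsilon> e p = 0" "amb_inner \<epsilon> e q = 0" "amb_inner \<epsilon> n p = 0" "amb_inner \<epsilon> n q = 0"
    "amb_inner \<epsilon> e n = 0"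
    by (rule trans[OF amb_inner_commute], fact)+
  have qp: "amb_inner \<epsilon> q p = amb_inner \<epsilon> p q"
    by (rule amb_inner_commute)
  have ip: "amb_inner \<epsilon> (L z) e = snd z * \<epsilon>" "amb_inner \<epsilon> (L z) n = fst z $ 3"
      "amb_inner \<epsilon> (L z) p = fst z $ 1 * amb_inner \<epsilon> p p + fst z $ 2 * amb_inner \<epsilon> p q"
      "amb_inner \<epsilon> (L z) q = fst z $ 1 * amb_inner \<epsilon> p q + fst z $ 2 * amb_inner \<epsilon> q q" for z
    by (simp_all add: L_def amb_inner_simps assms sym qp)
  have "inj L"
  proof (rule linear_injective_0[OF lin, THEN iffD2], intro allI impI)
    fix z assume "L z = 0"
    then have z: "snd z * \<epsilon> = 0" "fst z $ 3 = 0"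
      "fst z $ 1 * amb_inner \<epsilon> p p + fst z $ 2 * amb_inner \<epsilon> p q = 0"
      "fst z $ 1 * amb_inner \<epsilon> p q + fst z $ 2 * amb_inner \<epsilon> q q = 0"
      using ip[of z] by (simp_all add: amb_inner_simps)
    have "fst z $ 1 * (amb_inner \<epsilon> p p * amb_inner \<epsilon> q q - amb_inner \<epsilon> p q * amb_inner \<epsilon> p q) = 0"
      "fst z $ 2 * (amb_inner \<epsilon> p p * amb_inner \<epsilon> q q - amb_inner \<epsilon> p q * amb_inner \<epsilon> p q) = 0"
      using z(3,4) by algebra+
    with z D assms(1) show "z = 0"
      by (auto simp: prod_eq_iff vec_eq_iff forall_3)
  qed
  then have "surj L"
    using lin linear_injective_imp_surjective by blast
  then obtain z where z: "V = L z" by blast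
  have c: "\<epsilon> * amb_inner \<epsilon> V e = snd z" "amb_inner \<epsilon> V n = fst z $ 3"
    using ip[of z] assms(1) unfolding z by auto
  show thesis
    by (rule that[of "fst z $ 1" "fst z $ 2"], unfold c, unfold z L_def) (rule refl)
qed

text \<open>Multiplication by \<open>A x\<close> cancels the inverse matrix in the definition.
  Below, Christoffel symbols are handled through this linear system instead of through
  \<open>matrix_inv\<close>.\<close>

lemma christoffel_lower:
  assumes "det (A x) \<noteq> 0"
  shows "(\<Sum>k\<in>UNIV. A x $ l $ k * christoffel A i j k x) =
    (pd i (\<lambda>y. A y $ j $ l) x + pd j (\<lambda>y. A y $ i $ l) x - pd l (\<lambda>y. A y $ i $ j) x) / 2"
proof -
  define v :: "real^2" where "v = (\<chi> l. 1/2 *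
      (pd i (\<lambda>y. A y $ j $ l) x + pd j (\<lambda>y. A y $ i $ l) x - pd l (\<lambda>y. A y $ i $ j) x))"
  have "invertible (A x)" using assms invertible_det_nz by blast
  then have "A x ** matrix_inv (A x) = mat 1"
    unfolding invertible_def matrix_inv_def by (rule someI2_ex) simp
  then have "A x *v (matrix_inv (A x) *v v) = v"
    by (simp add: matrix_vector_mul_assoc)
  moreover have "(\<chi> k. christoffel A i j k x) = matrix_inv (A x) *v v"
    by (simp add: vec_eq_iff christoffel_def matrix_vector_mult_def v_def sum_distrib_left
        algebra_simps)
  ultimately have "A x *v (\<chi> k. christoffel A i j k x) = v" by simp
  then have "(A x *v (\<chi> k. christoffel A i j k x)) $ l = v $ l" by simp
  then show ?thesis by (simp add: matrix_vector_mult_def v_def)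
qed

lemma linear_system_2_unique:
  fixes a b c d :: real
  assumes "a * d - b * c \<noteq> 0"
    and "a * x + b * y = a * x' + b * y'" "c * x + d * y = c * x' + d * y'"
  shows "x = x'" "y = y'"
proof -
  have "(x - x') * (a * d - b * c) = 0" "(y - y') * (a * d - b * c) = 0"
    using assms(2,3) by algebra+
  then show "x = x'" "y = y'" using assms(1) by auto
qed

lemma linear_system_2_solution:
  fixes a b c d :: real
  assumes "a * d - b * c \<noteq> 0" "a * x + b * y = u" "c * x + d * y = v"
  shows "x = (d * u - b * v) / (a * d - b * c)" "y = (a * v - c * u) / (a * d - b * c)"
  using assms(1) by (simp_all add: field_simps assms(2,3)[symmetric])

lemma det_pos_definite_nz:
  fixes M :: "real^2^2"
  assumes "\<And>v. v \<noteq> 0 \<Longrightarrow> v \<bullet> (M *v v) > 0"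
  shows "det M \<noteq> 0"
proof
  assume "det M = 0"
  then obtain v where "v \<noteq> 0" "M *v v = 0"
    using invertible_det_nz[of M] matrix_left_invertible_ker[of M] invertible_left_inverse[of M] by metis
  with assms[of v] show False by simp
qed

section \<open>The structure equations of an immersed patch\<close>

text \<open>Christoffel symbols involve derivatives of the metric, hence equality on a
  neighbourhood. It serves to pass between the global form and the metric of a patch, which are
  shown to agree on the chart range.\<close>

lemma codazzi_equations_eq_on:
  assumes "open U" "x \<in> U" "\<And>y. y \<in> U \<Longrightarrow> A y = A' y" "codazzi_equations A' B x"
  shows "codazzi_equations A B x"
proof -
  have "pd i (\<lambda>y. A y $ j $ l) x = pd i (\<lambda>y. A' y $ j $ l) x" for i j l
    by (rule pd_eq_on[OF assms(1,2)]) (simp add: assms(3))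
  then have "christoffel A i j k x = christoffel A' i j k x" for i j k
    by (simp add: christoffel_def assms(2,3))
  with assms(4) show ?thesis
    by (simp add: codazzi_equations_def)
qed

text \<open>One chart of the surface: \<open>U\<close> plays the role of the chart range,
  \<open>\<Psi>\<close> and \<open>N\<close> of the local expressions, so that the structure
  equations concern maps on an open set of the plane.\<close>

locale immersed_patch =
  fixes \<epsilon> :: real and U :: "(real^2) set" and \<Psi> N :: "real^2 \<Rightarrow> (real^3) \<times> real"
  assumes eps: "\<epsilon> = 1 \<or> \<epsilon> = -1"
    and open_U: "open U"
    and smooth_\<Psi>: "smooth_on \<Psi> U"
    and smooth_N: "smooth_on N U"
    and in_M2: "x \<in> U \<Longrightarrow> M2_inner \<epsilon> (fst (\<Psi> x)) (fst (\<Psi> x)) = \<epsilon>"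
    and inj_d\<Psi>: "x \<in> U \<Longrightarrow> inj (frechet_derivative \<Psi> (at x))"
    and N_tangent: "x \<in> U \<Longrightarrow> M2_inner \<epsilon> (fst (N x)) (fst (\<Psi> x)) = 0"
    and N_unit: "x \<in> U \<Longrightarrow> amb_inner \<epsilon> (N x) (N x) = 1"
    and N_normal: "x \<in> U \<Longrightarrow> amb_inner \<epsilon> (N x) (frechet_derivative \<Psi> (at x) v) = 0"
begin

abbreviation ip where "ip \<equiv> amb_inner \<epsilon>"

abbreviation P :: "2 \<Rightarrow> real^2 \<Rightarrow> (real^3) \<times> real" where "P i \<equiv> pd i \<Psi>"

abbreviation H :: "2 \<Rightarrow> 2 \<Rightarrow> real^2 \<Rightarrow> (real^3) \<times> real" where "H i j \<equiv> pd i (P j)"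

abbreviation h :: "2 \<Rightarrow> real^2 \<Rightarrow> real" where "h i x \<equiv> snd (P i x)"

definition \<eta> :: "real^2 \<Rightarrow> (real^3) \<times> real" where "\<eta> x = (fst (\<Psi> x), 0)"

definition g :: "2 \<Rightarrow> 2 \<Rightarrow> real^2 \<Rightarrow> real" where "g i j x = ip (P i x) (P j x)"

text \<open>The second fundamental form through second derivatives of \<open>\<Psi>\<close>, which
  makes its symmetry immediate; \<open>pd_N_P\<close> links it to -dN.\<close>

definition b :: "2 \<Rightarrow> 2 \<Rightarrow> real^2 \<Rightarrow> real" where "b i j x = ip (N x) (H i j x)"

definition metric :: "real^2 \<Rightarrow> real^2^2" where "metric x = (\<chi> i j. g i j x)"

lemma smooth_P: "smooth_on (P i) U"
  using smooth_\<Psi> by (rule smooth_on_pd)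

lemma smooth_H: "smooth_on (H i j) U"
  using smooth_P by (rule smooth_on_pd)

lemma bounded_linear_\<eta>: "bounded_linear (\<lambda>p::(real^3) \<times> real. (fst p, 0::real))"
  by (intro bounded_linear_intros)

lemma differentiable:
  assumes "x \<in> U"
  shows "\<Psi> differentiable (at x)" "N differentiable (at x)" "P i differentiable (at x)"
    "H i j differentiable (at x)" "pd i N differentiable (at x)" "\<eta> differentiable (at x)"
proof -
  show d: "\<Psi> differentiable (at x)" "N differentiable (at x)" "P i differentiable (at x)"
    "H i j differentiable (at x)" "pd i N differentiable (at x)"
    using smooth_on_differentiable[OF _ open_U assms] smooth_\<Psi> smooth_N smooth_P smooth_H
      smooth_on_pd by blast+
  show "\<eta> differentiable (at x)"
    using frechet_derivative_bounded_linear(2)[OF bounded_linear_\<eta> d(1)] by (simp add: \<eta>_def[abs_def])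
qed

lemma pd_ip:
  "f differentiable (at x) \<Longrightarrow> f' differentiable (at x) \<Longrightarrow>
   pd i (\<lambda>y. ip (f y) (f' y)) x = ip (f x) (pd i f' x) + ip (pd i f x) (f' x)"
  by (rule pd_bilinear[OF bounded_bilinear_amb_inner])

lemma ip_differentiable:
  "f differentiable (at x) \<Longrightarrow> f' differentiable (at x) \<Longrightarrow>
   (\<lambda>y. ip (f y) (f' y)) differentiable (at x)"
  by (rule frechet_derivative_bilinear(2)[OF bounded_bilinear_amb_inner])

text \<open>Source of the first-order relations below: each constant product among the
  \<open>P i\<close>, \<open>N\<close> and \<open>\<eta>\<close> is differentiated once.\<close>

lemma pd_ip_const:
  assumes "x \<in> U" "f differentiable (at x)" "f' differentiable (at x)"
    and "\<And>y. y \<in> U \<Longrightarrow> ip (f y) (f' y) = c"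
  shows "ip (f x) (pd i f' x) + ip (pd i f x) (f' x) = 0"
  using pd_eq_on[OF open_U assms(1,4), where i=i] pd_ip[OF assms(2,3), where i=i] by (simp add: pd_const)

lemma H_commute: "x \<in> U \<Longrightarrow> H i j x = H j i x"
  using pd_commute[OF smooth_\<Psi> open_U] .

lemma pd_H_commute: "x \<in> U \<Longrightarrow> pd k (H i j) x = pd i (H k j) x"
  using pd_commute[OF smooth_P open_U] .

lemma pd_\<eta>: "x \<in> U \<Longrightarrow> pd i \<eta> x = (fst (P i x), 0)"
  unfolding \<eta>_def[abs_def] by (rule pd_bounded_linear[OF bounded_linear_\<eta> differentiable(1)])

lemma pd_h: "x \<in> U \<Longrightarrow> pd i (h j) x = snd (H i j x)"
  by (rule pd_bounded_linear[OF bounded_linear_snd differentiable(3)])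

lemma ip_\<eta>: "ip p (\<eta> x) = M2_inner \<epsilon> (fst p) (fst (\<Psi> x))"
  by (simp add: \<eta>_def amb_inner_def)

lemma \<eta>_\<eta>: "x \<in> U \<Longrightarrow> ip (\<eta> x) (\<eta> x) = \<epsilon>"
  using in_M2 by (simp add: ip_\<eta>) (simp add: \<eta>_def)

lemma N_\<eta>: "x \<in> U \<Longrightarrow> ip (N x) (\<eta> x) = 0"
  using N_tangent by (simp add: ip_\<eta>)

lemma N_P: "x \<in> U \<Longrightarrow> ip (N x) (P i x) = 0"
  using N_normal by (simp add: pd_def)

lemma P_\<eta>: assumes "x \<in> U" shows "ip (P i x) (\<eta> x) = 0"
proof -
  have "ip (\<eta> x) (pd i \<eta> x) = ip (P i x) (\<eta> x)"
    using pd_\<eta>[OF assms, of i] by (simp add: \<eta>_def amb_inner_def M2_inner_commute)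
  moreover have "ip (pd i \<eta> x) (\<eta> x) = ip (\<eta> x) (pd i \<eta> x)"
    by (rule amb_inner_commute)
  ultimately show ?thesis
    using pd_ip_const[OF assms differentiable(6,6)[OF assms] \<eta>_\<eta>, where i=i] by linarith
qed

lemma pd_N_P: assumes "x \<in> U" shows "ip (pd i N x) (P j x) = - b i j x"
  using pd_ip_const[OF assms differentiable(2)[OF assms] differentiable(3)[OF assms, of j] N_P, where i=i]
  by (simp add: b_def)

lemma pd_N_N: assumes "x \<in> U" shows "ip (pd i N x) (N x) = 0"
  using pd_ip_const[OF assms differentiable(2,2)[OF assms] N_unit, where i=i]
    amb_inner_commute[of \<epsilon> "N x" "pd i N x"] by simp

text \<open>The derivative of \<open>\<eta>\<close> is only the horizontal part of
  \<open>P i\<close>, so its product with \<open>N\<close> falls short of <N, P i> = 0 by the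
  product of the vertical components. This defect is the origin of the error term in
  \<open>codazzi_immersion\<close>.\<close>

lemma pd_N_\<eta>: assumes "x \<in> U" shows "ip (pd i N x) (\<eta> x) = snd (N x) * h i x"
proof -
  have "ip (N x) (pd i \<eta> x) + snd (N x) * h i x = ip (N x) (P i x)"
    using pd_\<eta>[OF assms, of i] by (simp add: amb_inner_def)
  then show ?thesis
    using pd_ip_const[OF assms differentiable(2,6)[OF assms] N_\<eta>, where i=i] N_P[OF assms, of i]
    by linarith
qed

text \<open>Differentiating <P j, \<eta>> = 0 leaves minus the product of the horizontal parts of
  \<open>P i\<close> and \<open>P j\<close>, that is, minus the coefficient of I - dh^2.\<close>

lemma H_\<eta>: assumes "x \<in> U" shows "ip (H i j x) (\<eta> x) = - (g i j x - h i x * h j x)"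
proof -
  have "ip (P j x) (pd i \<eta> x) + h i x * h j x = g j i x"
    using pd_\<eta>[OF assms, of i] by (simp add: amb_inner_def g_def)
  moreover have "g j i x = g i j x" by (simp add: g_def amb_inner_commute)
  ultimately show ?thesis
    using pd_ip_const[OF assms differentiable(3)[OF assms, of j] differentiable(6)[OF assms] P_\<eta>, where i=i] by linarith
qed

lemma g_sym: "g i j x = g j i x"
  by (simp add: g_def amb_inner_commute)

lemma b_sym: "x \<in> U \<Longrightarrow> b i j x = b j i x"
  by (simp add: b_def H_commute)

text \<open>The image of \<open>v\<close> under the differential is nonzero by injectivity and
  tangent to M2(\<epsilon>) x R, where the ambient form is positive.\<close>

lemma g_pos_definite:
  fixes v :: "real^2"
  assumes "x \<in> U" "v \<noteq> 0"
  shows "g 1 1 x * (v$1 * v$1) + 2 * g 1 2 x * (v$1 * v$2) + g 2 2 x * (v$2 * v$2) > 0"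
proof -
  define V where "V = (v$1) *\<^sub>R P 1 x + (v$2) *\<^sub>R P 2 x"
  have V: "V = frechet_derivative \<Psi> (at x) v"
    using frechet_derivative_pd[OF differentiable(1)[OF assms(1)], of v] by (simp add: V_def)
  have "linear (frechet_derivative \<Psi> (at x))"
    using differentiable(1)[OF assms(1)] frechet_derivative_works has_derivative_linear by blast
  then have "V \<noteq> 0"
    using inj_d\<Psi>[OF assms(1)] assms(2) linear_injective_0 unfolding V by blast
  moreover have "M2_inner \<epsilon> (fst V) (fst (\<Psi> x)) = 0"
    using P_\<eta>[OF assms(1)] ip_\<eta>[of V x] by (simp add: V_def amb_inner_simps)
  ultimately have "ip V V > 0"
    using amb_inner_tangent_pos[OF eps in_M2[OF assms(1)]] by blast
  moreover have "ip V V = v$1 * (v$1 * g 1 1 x + v$2 * g 1 2 x) + v$2 * (v$1 * g 2 1 x + v$2 * g 2 2 x)"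
    by (simp add: V_def amb_inner_simps g_def algebra_simps)
  ultimately show ?thesis
    by (simp add: g_sym[of 2 1] algebra_simps)
qed

lemma det_g_pos:
  assumes "x \<in> U" shows "g 1 1 x * g 2 2 x - g 1 2 x * g 1 2 x > 0"
proof -
  have E: "g 1 1 x > 0"
    using g_pos_definite[OF assms, of "\<chi> i. if i = 1 then 1 else 0"] by (simp add: vec_eq_iff)
  \<comment> \<open>At the vector (-F, E) the form takes the value E (E G - F^2).\<close>
  define v :: "real^2" where "v = (\<chi> i. if i = 1 then - g 1 2 x else g 1 1 x)"
  have v: "v$1 = - g 1 2 x" "v$2 = g 1 1 x" by (simp_all add: v_def)
  then have "v \<noteq> 0" using E by force
  from g_pos_definite[OF assms this] have "g 1 1 x * (g 1 1 x * g 2 2 x - g 1 2 x * g 1 2 x) > 0"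
    unfolding v by (simp add: algebra_simps)
  then show ?thesis using E by (simp add: zero_less_mult_iff)
qed

lemma det_metric: "det (metric x) = g 1 1 x * g 2 2 x - g 1 2 x * g 1 2 x"
  by (simp add: det_2 metric_def g_sym[of 2 1])

section \<open>Christoffel symbols of the first form, Gauss formula and Codazzi equations\<close>

abbreviation \<Gamma> :: "2 \<Rightarrow> 2 \<Rightarrow> 2 \<Rightarrow> real^2 \<Rightarrow> real" where
  "\<Gamma> \<equiv> christoffel metric"

lemma pd_g:
  "x \<in> U \<Longrightarrow> pd i (g j k) x = ip (P j x) (H i k x) + ip (H i j x) (P k x)"
  unfolding g_def[abs_def] by (rule pd_ip) (rule differentiable(3), assumption)+

lemma metric_component: "metric x $ i $ j = g i j x"
  by (simp add: metric_def)

text \<open>Of the six products from the three metric derivatives, symmetry of second derivatives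
  cancels four and identifies the other two.\<close>

lemma christoffel_first_kind:
  assumes "x \<in> U"
  shows "(pd i (g j l) x + pd j (g i l) x - pd l (g i j) x) / 2 = ip (H i j x) (P l x)"
  using assms by (simp add: pd_g H_commute[of x j i] H_commute[of x l] amb_inner_commute)

lemma \<Gamma>_lower:
  assumes "x \<in> U"
  shows "g l 1 x * \<Gamma> i j 1 x + g l 2 x * \<Gamma> i j 2 x = ip (H i j x) (P l x)"
proof -
  have "det (metric x) \<noteq> 0" using det_g_pos[OF assms] by (simp add: det_metric)
  from christoffel_lower[where A=metric and x=x and l=l and i=i and j=j, OF this] show ?thesis
    using christoffel_first_kind[OF assms, of i j l]
    by (simp add: metric_component sum_2)
qed

lemma \<Gamma>_sym:
  assumes "x \<in> U" shows "\<Gamma> i j k x = \<Gamma> j i k x"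
proof -
  have *: "g l 1 x * \<Gamma> i j 1 x + g l 2 x * \<Gamma> i j 2 x = g l 1 x * \<Gamma> j i 1 x + g l 2 x * \<Gamma> j i 2 x" for l
    using \<Gamma>_lower[OF assms] H_commute[OF assms, of i j] by metis
  have "g 1 1 x * g 2 2 x - g 1 2 x * g 2 1 x \<noteq> 0"
    using det_g_pos[OF assms] by (simp add: g_sym[of 2 1])
  from linear_system_2_unique[OF this *[of 1] *[of 2]] show ?thesis
    using exhaust_2[of k] by auto
qed

text \<open>The frame decomposition gives the normal coefficients. Pairing with the
  \<open>P l\<close> shows that the tangential ones solve the same nonsingular system as the
  Christoffel symbols in \<open>\<Gamma>_lower\<close>.\<close>

lemma gauss_formula:
  assumes "x \<in> U"
  shows "H i j x = \<Gamma> i j 1 x *\<^sub>R P 1 x + \<Gamma> i j 2 x *\<^sub>R P 2 x + b i j x *\<^sub>R N x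
    + (- \<epsilon> * (g i j x - h i x * h j x)) *\<^sub>R \<eta> x"
proof -
  have gs: "ip (P i x) (P j x) = g i j x" for i j by (simp add: g_def)
  have "ip (P 1 x) (P 1 x) * ip (P 2 x) (P 2 x) - ip (P 1 x) (P 2 x) * ip (P 1 x) (P 2 x) \<noteq> 0"
    using det_g_pos[OF assms] by (simp add: gs)
  then obtain u v where V: "H i j x = u *\<^sub>R P 1 x + v *\<^sub>R P 2 x + ip (H i j x) (N x) *\<^sub>R N x
      + (\<epsilon> * ip (H i j x) (\<eta> x)) *\<^sub>R \<eta> x"
    using frame_decomposition[OF eps \<eta>_\<eta>[OF assms] N_unit[OF assms] N_\<eta>[OF assms] P_\<eta>[OF assms] P_\<eta>[OF assms]
       trans[OF amb_inner_commute N_P[OF assms]] trans[OF amb_inner_commute N_P[OF assms]]]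
    by blast
  have Hn: "ip (H i j x) (N x) = b i j x"
    unfolding b_def by (rule amb_inner_commute)
  have "ip (\<eta> x) (P l x) = 0" for l
    using P_\<eta>[OF assms] amb_inner_commute by metis
  then have *: "g l 1 x * u + g l 2 x * v = g l 1 x * \<Gamma> i j 1 x + g l 2 x * \<Gamma> i j 2 x" for l
    unfolding \<Gamma>_lower[OF assms]
    by (subst V) (simp add: amb_inner_simps N_P[OF assms] gs g_sym[of _ l])
  have "g 1 1 x * g 2 2 x - g 1 2 x * g 2 1 x \<noteq> 0"
    using det_g_pos[OF assms] by (simp add: g_sym[of 2 1])
  from linear_system_2_unique[OF this *[of 1] *[of 2]] V show ?thesis
    unfolding Hn H_\<eta>[OF assms] by (simp add: algebra_simps)
qed

lemma height_hessian:
  assumes "x \<in> U"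
  shows "snd (H i j x) = \<Gamma> i j 1 x * h 1 x + \<Gamma> i j 2 x * h 2 x + b i j x * snd (N x)"
  by (subst gauss_formula[OF assms]) (simp add: \<eta>_def)

text \<open>Only the second factor is expanded by the Gauss formula; the remaining products of
  \<open>H\<close> with \<open>P\<close> are rewritten through \<open>\<Gamma>_lower\<close> in
  \<open>gauss_equation\<close>.\<close>

lemma H_H:
  assumes "x \<in> U"
  shows "ip (H i j x) (H k l x) =
    \<Gamma> k l 1 x * ip (H i j x) (P 1 x) + \<Gamma> k l 2 x * ip (H i j x) (P 2 x) + b i j x * b k l x
    + \<epsilon> * (g i j x - h i x * h j x) * (g k l x - h k x * h l x)"
  by (subst gauss_formula[OF assms, of k l])
    (simp add: amb_inner_simps H_\<eta>[OF assms] b_def amb_inner_commute[of _ _ "N x"] algebra_simps)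

lemma pd_N_H:
  assumes "x \<in> U"
  shows "ip (pd m N x) (H i j x) = - \<Gamma> i j 1 x * b m 1 x - \<Gamma> i j 2 x * b m 2 x
    - \<epsilon> * (g i j x - h i x * h j x) * (snd (N x) * h m x)"
  by (subst gauss_formula[OF assms, of i j])
    (simp add: amb_inner_simps pd_N_\<eta>[OF assms] pd_N_P[OF assms] pd_N_N[OF assms])

text \<open>Third derivatives of \<open>\<Psi>\<close> enter only paired with \<open>N\<close> and
  cancel by symmetry. The remaining products of dN with \<open>H\<close> give the Christoffel terms,
  and the \<open>\<eta>\<close> component of dN gives the error term, whose cubic part in dh
  cancels.\<close>

lemma codazzi_immersion:
  assumes "x \<in> U"
  shows "pd 2 (b 1 i) x - pd 1 (b 2 i) x =
    \<Gamma> 2 i 1 x * b 1 1 x + \<Gamma> 2 i 2 x * b 1 2 x - \<Gamma> 1 i 1 x * b 2 1 x - \<Gamma> 1 i 2 x * b 2 2 x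
    - \<epsilon> * snd (N x) * (g 1 i x * h 2 x - g 2 i x * h 1 x)"
proof -
  have eq: "pd m (b j i) x = ip (N x) (pd m (H j i) x) + ip (pd m N x) (H j i x)" for m j
    unfolding b_def[abs_def] by (rule pd_ip) (rule differentiable(2,4)[OF assms])+
  show ?thesis
    by (simp add: eq pd_H_commute[OF assms, of 2 1 i] pd_N_H[OF assms] algebra_simps)
qed

section \<open>The Gauss equation\<close>

lemma g_differentiable: "x \<in> U \<Longrightarrow> g i j differentiable (at x)"
  unfolding g_def[abs_def] by (rule ip_differentiable) (rule differentiable(3), assumption)+

text \<open>Cramer's rule writes the symbols on \<open>U\<close> as quotients of differentiable
  functions; the curvature contains their derivatives.\<close>

lemma \<Gamma>_differentiable:
  assumes "x \<in> U" shows "\<Gamma> i j k differentiable (at x)"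
proof -
  let ?D = "\<lambda>y. g 1 1 y * g 2 2 y - g 1 2 y * g 2 1 y"
  let ?L = "\<lambda>l y. ip (H i j y) (P l y)"
  have D: "?D y \<noteq> 0" if "y \<in> U" for y
    using det_g_pos[OF that] by (simp add: g_sym[of 2 1])
  have L: "?L l differentiable (at x)" for l
    by (rule ip_differentiable) (rule differentiable(3,4)[OF assms])+
  have sol: "(g 2 2 y * ?L 1 y - g 1 2 y * ?L 2 y) / ?D y = \<Gamma> i j 1 y"
    "(g 1 1 y * ?L 2 y - g 2 1 y * ?L 1 y) / ?D y = \<Gamma> i j 2 y" if "y \<in> U" for y
    using linear_system_2_solution[OF D \<Gamma>_lower[of _ 1 i j] \<Gamma>_lower[of _ 2 i j]] that by metis+
  have d: "(\<lambda>y. (g 2 2 y * ?L 1 y - g 1 2 y * ?L 2 y) / ?D y) differentiable (at x)"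
    "(\<lambda>y. (g 1 1 y * ?L 2 y - g 2 1 y * ?L 1 y) / ?D y) differentiable (at x)"
    by (intro differentiable_divide differentiable_diff differentiable_mult L
        g_differentiable[OF assms] D[OF assms])+
  have "\<Gamma> i j 1 differentiable (at x)"
    by (rule differentiable_at_eq_on[OF open_U assms _ d(1)]) (rule sol(1))
  moreover have "\<Gamma> i j 2 differentiable (at x)"
    by (rule differentiable_at_eq_on[OF open_U assms _ d(2)]) (rule sol(2))
  ultimately show ?thesis
    using exhaust_2[of k] by auto
qed

text \<open>Differentiating the lowered relation as a whole yields derivatives of the symbols
  already contracted with the metric, as they occur in the curvature.\<close>

lemma pd_\<Gamma>_lower:
  assumes "x \<in> U"
  shows "pd k (g l 1) x * \<Gamma> i j 1 x + g l 1 x * pd k (\<Gamma> i j 1) x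
       + pd k (g l 2) x * \<Gamma> i j 2 x + g l 2 x * pd k (\<Gamma> i j 2) x
       = ip (H i j x) (H k l x) + ip (pd k (H i j) x) (P l x)"
proof -
  note d = g_differentiable[OF assms] \<Gamma>_differentiable[OF assms]
  have m: "(\<lambda>y. g l m y * \<Gamma> i j m y) differentiable (at x)" for m
    by (intro differentiable_mult d)
  have "pd k (\<lambda>y. g l 1 y * \<Gamma> i j 1 y + g l 2 y * \<Gamma> i j 2 y) x =
      pd k (\<lambda>y. ip (H i j y) (P l y)) x"
    by (rule pd_eq_on[OF open_U assms \<Gamma>_lower])
  then show ?thesis
    by (simp add: pd_plus[OF m m] pd_bilinear[OF bounded_bilinear_mult d(1) d(2)]
        pd_ip[OF differentiable(4)[OF assms] differentiable(3)[OF assms]])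
qed

text \<open>Subtracting two instances of \<open>pd_\<Gamma>_lower\<close> cancels the third
  derivatives of \<open>\<Psi>\<close> and leaves <H 2 2, H 1 1> - <H 1 2, H 1 2>. By
  \<open>H_H\<close> its normal part is the right-hand side; the rest is absorbed by the quadratic
  Christoffel terms of the curvature and the derivatives of the metric.\<close>

lemma gauss_equation:
  assumes "x \<in> U"
  shows "gauss_curvature metric x * det (metric x) =
    b 1 1 x * b 2 2 x - b 1 2 x * b 1 2 x +
    \<epsilon> * ((g 1 1 x - h 1 x * h 1 x) * (g 2 2 x - h 2 x * h 2 x)
      - (g 1 2 x - h 1 x * h 2 x) * (g 1 2 x - h 1 x * h 2 x))"
proof -
  have D: "det (metric x) \<noteq> 0" using det_g_pos[OF assms] by (simp add: det_metric)
  have P_H: "ip (P l x) (H i j x) = g l 1 x * \<Gamma> i j 1 x + g l 2 x * \<Gamma> i j 2 x" for i j l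
    using \<Gamma>_lower[OF assms, of l i j] amb_inner_commute[of \<epsilon> "P l x" "H i j x"] by simp
  note lower = \<Gamma>_lower[OF assms, symmetric] P_H
  note sym = g_sym[of 2 1] H_commute[OF assms, of 2 1] \<Gamma>_sym[OF assms, of 2 1] b_sym[OF assms, of 2 1]
  have third: "pd 1 (H 2 2) x = pd 2 (H 1 2) x"
    by (rule pd_H_commute[OF assms])
  have "gauss_curvature metric x * det (metric x) =
     g 1 1 x * (pd 1 (\<Gamma> 2 2 1) x - pd 2 (\<Gamma> 1 2 1) x +
        (\<Gamma> 2 2 1 x * \<Gamma> 1 1 1 x - \<Gamma> 1 2 1 x * \<Gamma> 1 2 1 x + \<Gamma> 2 2 2 x * \<Gamma> 1 2 1 x - \<Gamma> 1 2 2 x * \<Gamma> 2 2 1 x)) +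
     g 1 2 x * (pd 1 (\<Gamma> 2 2 2) x - pd 2 (\<Gamma> 1 2 2) x +
        (\<Gamma> 2 2 1 x * \<Gamma> 1 1 2 x - \<Gamma> 1 2 1 x * \<Gamma> 1 2 2 x + \<Gamma> 2 2 2 x * \<Gamma> 1 2 2 x - \<Gamma> 1 2 2 x * \<Gamma> 2 2 2 x))"
    using D by (simp add: gauss_curvature_def sum_2 metric_component sym)
  moreover have "pd 1 (g 1 1) x * \<Gamma> 2 2 1 x + g 1 1 x * pd 1 (\<Gamma> 2 2 1) x
       + pd 1 (g 1 2) x * \<Gamma> 2 2 2 x + g 1 2 x * pd 1 (\<Gamma> 2 2 2) x
       = ip (H 2 2 x) (H 1 1 x) + ip (pd 2 (H 1 2) x) (P 1 x)"
    using pd_\<Gamma>_lower[OF assms, of 1 1 2 2] by (simp add: third)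
  moreover have "pd 2 (g 1 1) x * \<Gamma> 1 2 1 x + g 1 1 x * pd 2 (\<Gamma> 1 2 1) x
       + pd 2 (g 1 2) x * \<Gamma> 1 2 2 x + g 1 2 x * pd 2 (\<Gamma> 1 2 2) x
       = ip (H 1 2 x) (H 1 2 x) + ip (pd 2 (H 1 2) x) (P 1 x)"
    using pd_\<Gamma>_lower[OF assms, of 2 1 1 2] by (simp add: sym)
  ultimately show ?thesis
    unfolding pd_g[OF assms] H_H[OF assms] lower sym by algebra
qed

end

section \<open>The metric A on a patch of constant Gaussian curvature\<close>

locale immersed_patch_constant_curvature = immersed_patch +
  fixes k :: real
  assumes curvature: "x \<in> U \<Longrightarrow> gauss_curvature metric x = k" and k: "k \<noteq> \<epsilon>"
begin

definition c :: real where "c = 1 / (\<epsilon> * k - 1)"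

definition a :: "2 \<Rightarrow> 2 \<Rightarrow> real^2 \<Rightarrow> real" where
  "a i j x = g i j x + c * (h i x * h j x)"

definition A :: "real^2 \<Rightarrow> real^2^2" where "A x = (\<chi> i j. a i j x)"

lemma A_component: "A x $ i $ j = a i j x"
  by (simp add: A_def)

lemma a_sym: "a i j x = a j i x"
  by (simp add: a_def g_sym)

lemma det_A: "det (A x) = a 1 1 x * a 2 2 x - a 1 2 x * a 1 2 x"
  by (simp add: det_2 A_component a_sym[of 2 1])

text \<open>Since \<epsilon>^2 = 1, the denominator \<epsilon> k - 1 equals \<epsilon> (k -
  \<epsilon>), and 1 / \<epsilon> = \<epsilon>.\<close>

lemma coefficient: "c * (k - \<epsilon>) = \<epsilon>"
  using eps k by (auto simp: c_def field_simps)

lemma det_b: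
  assumes "x \<in> U"
  shows "b 1 1 x * b 2 2 x - b 1 2 x * b 1 2 x = (k - \<epsilon>) * det (A x)"
proof -
  \<comment> \<open>\<open>?q\<close> is the slope in t of det (I + t dh^2): the Gauss equation
    involves t = -1, the metric \<open>A\<close> has t = c. Its factor \<epsilon> in the Gauss
    equation is rewritten as c (k - \<epsilon>).\<close>
  let ?q = "g 1 1 x * (h 2 x * h 2 x) - 2 * g 1 2 x * (h 1 x * h 2 x) + g 2 2 x * (h 1 x * h 1 x)"
  have "k * (g 1 1 x * g 2 2 x - g 1 2 x * g 1 2 x) =
    b 1 1 x * b 2 2 x - b 1 2 x * b 1 2 x +
    \<epsilon> * ((g 1 1 x - h 1 x * h 1 x) * (g 2 2 x - h 2 x * h 2 x)
      - (g 1 2 x - h 1 x * h 2 x) * (g 1 2 x - h 1 x * h 2 x))"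
    using gauss_equation[OF assms] curvature[OF assms] by (simp add: det_metric)
  then have "b 1 1 x * b 2 2 x - b 1 2 x * b 1 2 x =
      (k - \<epsilon>) * (g 1 1 x * g 2 2 x - g 1 2 x * g 1 2 x) + c * (k - \<epsilon>) * ?q"
    unfolding coefficient by (simp add: algebra_simps)
  also have "\<dots> = (k - \<epsilon>) * det (A x)"
    by (simp add: det_A a_def algebra_simps)
  finally show ?thesis .
qed

lemma pd_a:
  assumes "x \<in> U"
  shows "pd i (a j l) x = pd i (g j l) x + c * (h j x * snd (H i l x) + snd (H i j x) * h l x)"
proof -
  have hd: "h i differentiable (at x)" for i
    by (rule frechet_derivative_bounded_linear(2)[OF bounded_linear_snd differentiable(3)[OF assms]])
  have hh: "(\<lambda>y. h j y * h l y) differentiable (at x)"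
    by (intro differentiable_mult hd)
  have "pd i (\<lambda>y. c * (h j y * h l y)) x =
      c * pd i (\<lambda>y. h j y * h l y) x"
    by (rule pd_bounded_linear[OF bounded_linear_mult_right hh])
  moreover have "(\<lambda>y. c * (h j y * h l y)) differentiable (at x)"
    by (rule frechet_derivative_bounded_linear(2)[OF bounded_linear_mult_right hh])
  ultimately show ?thesis
    unfolding a_def[abs_def]
    by (simp add: pd_plus[OF g_differentiable[OF assms]] pd_bilinear[OF bounded_bilinear_mult hd hd]
        pd_h[OF assms])
qed

text \<open>The cancellation of \<open>christoffel_first_kind\<close> repeats itself for dh^2 and
  leaves the second derivative of the height times dh.\<close>

lemma christoffel_A_lower:
  assumes "x \<in> U" "det (A x) \<noteq> 0"
  shows "a l 1 x * christoffel A i j 1 x + a l 2 x * christoffel A i j 2 x =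
    ip (H i j x) (P l x) + c * (snd (H i j x) * h l x)"
proof -
  have *: "(pd i (a j l) x + pd j (a i l) x - pd l (a i j) x) / 2 =
    (pd i (g j l) x + pd j (g i l) x - pd l (g i j) x) / 2 + c * (snd (H i j x) * h l x)"
    unfolding pd_a[OF assms(1)] H_commute[OF assms(1), of j i]
      H_commute[OF assms(1), of l] by algebra
  show ?thesis
    using christoffel_lower[where A=A and x=x and l=l and i=i and j=j, OF assms(2)]
    unfolding A_component sum_2 * christoffel_first_kind[OF assms(1)] .
qed

text \<open>The gradient of the height function for the metric \<open>A\<close>.\<close>

definition w1 :: "real^2 \<Rightarrow> real" where "w1 x = (a 2 2 x * h 1 x - a 1 2 x * h 2 x) / det (A x)"

definition w2 :: "real^2 \<Rightarrow> real" where "w2 x = (a 1 1 x * h 2 x - a 1 2 x * h 1 x) / det (A x)"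

text \<open>After inserting \<open>height_hessian\<close>, the terms c \<Gamma>^k h_k h_l turn the
  symbols lowered by \<open>g\<close> into symbols lowered by \<open>a\<close>. What remains is c
  \<nu> b h_l, and h_l is the gradient \<open>w1\<close>, \<open>w2\<close> lowered by
  \<open>a\<close>; uniqueness for the linear system finishes.\<close>

lemma christoffel_A:
  assumes "x \<in> U" "det (A x) \<noteq> 0"
  shows "christoffel A i j 1 x = \<Gamma> i j 1 x + c * snd (N x) * b i j x * w1 x"
    "christoffel A i j 2 x = \<Gamma> i j 2 x + c * snd (N x) * b i j x * w2 x"
proof -
  have D: "a 1 1 x * a 2 2 x - a 1 2 x * a 2 1 x \<noteq> 0"
    using assms(2) by (simp add: det_A a_sym[of 2 1])
  have w: "w1 x * det (A x) = a 2 2 x * h 1 x - a 1 2 x * h 2 x"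
    "w2 x * det (A x) = a 1 1 x * h 2 x - a 1 2 x * h 1 x"
    using assms(2) by (simp_all add: w1_def w2_def)
  have "det (A x) * (a 1 1 x * w1 x + a 1 2 x * w2 x) = det (A x) * h 1 x"
    using w unfolding det_A by algebra
  moreover have "det (A x) * (a 2 1 x * w1 x + a 2 2 x * w2 x) = det (A x) * h 2 x"
    using w unfolding det_A a_sym[of 2 1] by algebra
  ultimately have aw: "a 1 1 x * w1 x + a 1 2 x * w2 x = h 1 x" "a 2 1 x * w1 x + a 2 2 x * w2 x = h 2 x"
    using assms(2) by simp_all
  then have aw': "a l 1 x * w1 x + a l 2 x * w2 x = h l x" for l
    using exhaust_2[of l] by auto
  have "a l 1 x * christoffel A i j 1 x + a l 2 x * christoffel A i j 2 x =
    a l 1 x * (\<Gamma> i j 1 x + c * snd (N x) * b i j x * w1 x) +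
    a l 2 x * (\<Gamma> i j 2 x + c * snd (N x) * b i j x * w2 x)" for l
  proof -
    have "a l 1 x * christoffel A i j 1 x + a l 2 x * christoffel A i j 2 x =
       a l 1 x * \<Gamma> i j 1 x + a l 2 x * \<Gamma> i j 2 x + c * snd (N x) * b i j x * h l x"
      unfolding christoffel_A_lower[OF assms] height_hessian[OF assms(1)]
        \<Gamma>_lower[OF assms(1), symmetric] unfolding a_def by algebra
    then show ?thesis
      unfolding aw'[of l, symmetric] by algebra
  qed
  from linear_system_2_unique[OF D this[of 1] this[of 2]]
  show "christoffel A i j 1 x = \<Gamma> i j 1 x + c * snd (N x) * b i j x * w1 x"
    "christoffel A i j 2 x = \<Gamma> i j 2 x + c * snd (N x) * b i j x * w2 x"
    by auto
qed

lemma codazzi_A: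
  assumes "x \<in> U" "det (A x) \<noteq> 0" and B: "\<And>y i j. y \<in> U \<Longrightarrow> B y $ i $ j = b i j y"
  shows "codazzi_equations A B x"
proof -
  let ?\<nu> = "snd (N x)"
  have pdB: "pd m (\<lambda>y. B y $ i $ j) x = pd m (b i j) x" for m i j
    by (rule pd_eq_on[OF open_U assms(1) B])
  have pdb: "pd m (b 2 1) x = pd m (b 1 2) x" for m
    by (rule pd_eq_on[OF open_U assms(1) b_sym])
  have w: "w1 x * det (A x) = a 2 2 x * h 1 x - a 1 2 x * h 2 x"
    "w2 x * det (A x) = a 1 1 x * h 2 x - a 1 2 x * h 1 x"
    using assms(2) by (simp_all add: w1_def w2_def)
  note sym = g_sym[of 2 1] \<Gamma>_sym[OF assms(1), of 2 1] b_sym[OF assms(1), of 2 1] pdb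
  note det = det_b[OF assms(1)] coefficient
  have "c * w2 x * (b 1 1 x * b 2 2 x - b 1 2 x * b 1 2 x) = \<epsilon> * (w2 x * det (A x))"
    using det by algebra
  \<comment> \<open>The contributions of c dh^2 to \<open>a\<close> cancel here, so \<open>g\<close>
    may replace \<open>a\<close>.\<close>
  also have "\<dots> = \<epsilon> * (g 1 1 x * h 2 x - g 1 2 x * h 1 x)"
    unfolding w a_def by algebra
  finally have 1: "c * w2 x * (b 1 1 x * b 2 2 x - b 1 2 x * b 1 2 x) =
      \<epsilon> * (g 1 1 x * h 2 x - g 1 2 x * h 1 x)" .
  have "c * w1 x * (b 1 1 x * b 2 2 x - b 1 2 x * b 1 2 x) = \<epsilon> * (w1 x * det (A x))"
    using det by algebra
  also have "\<dots> = \<epsilon> * (g 2 2 x * h 1 x - g 1 2 x * h 2 x)"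
    unfolding w a_def by algebra
  finally have 2: "c * w1 x * (b 1 1 x * b 2 2 x - b 1 2 x * b 1 2 x) =
      \<epsilon> * (g 2 2 x * h 1 x - g 1 2 x * h 2 x)" .
  \<comment> \<open>The change of Christoffel symbols adds -c \<nu> \<open>w2\<close> det II to the
    right-hand side of this equation, and c \<nu> \<open>w1\<close> det II to that of the next. By
    facts 1 and 2 these are the error terms of \<open>codazzi_immersion\<close>.\<close>
  have "pd 2 (b 1 1) x - pd 1 (b 1 2) x = b 1 1 x * christoffel A 1 2 1 x
      + b 1 2 x * (christoffel A 1 2 2 x - christoffel A 1 1 1 x) - b 2 2 x * christoffel A 1 1 2 x"
    using codazzi_immersion[OF assms(1), of 1] 1
    unfolding christoffel_A[OF assms(1,2)] sym by algebra
  moreover have "pd 2 (b 1 2) x - pd 1 (b 2 2) x = b 1 1 x * christoffel A 2 2 1 x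
      + b 1 2 x * (christoffel A 2 2 2 x - christoffel A 1 2 1 x) - b 2 2 x * christoffel A 1 2 2 x"
    using codazzi_immersion[OF assms(1), of 2] 2
    unfolding christoffel_A[OF assms(1,2)] sym by algebra
  ultimately show ?thesis
    by (simp add: codazzi_equations_def Let_def pdB B[OF assms(1)])
qed

lemma extrinsic_curvature_A:
  assumes "x \<in> U" "det (A x) \<noteq> 0" and B: "\<And>y i j. y \<in> U \<Longrightarrow> B y $ i $ j = b i j y"
  shows "extrinsic_curvature A B x = k - \<epsilon>"
  using det_b[OF assms(1)] assms(2)
  by (simp add: extrinsic_curvature_def A_component B[OF assms(1)] det_A power2_eq_square)

end

section \<open>Charts\<close>

lemma is_chart_inj_on: "is_chart X c \<Longrightarrow> inj_on (snd c) (chart_dom c)"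
  unfolding is_chart_def
  by (metis homeomorphic_imp_injective_map topspace_subtopology_subset openin_subset)

lemma chart_inverse:
  assumes "is_chart X c" "p \<in> chart_dom c"
  shows "inv_into (chart_dom c) (snd c) (snd c p) = p"
  using is_chart_inj_on[OF assms(1)] assms(2) by simp

lemma local_expr_chart:
  "is_chart X c \<Longrightarrow> p \<in> chart_dom c \<Longrightarrow> local_expr f c (snd c p) = f p"
  by (simp add: local_expr_def chart_inverse)

text \<open>The overlap is relatively open in the chart range, which is itself open in the
  plane.\<close>

lemma open_overlap:
  assumes "is_chart X c" "is_chart X d"
  shows "open (overlap c d)"
proof -
  have "open_map (subtopology X (chart_dom c)) (top_of_set (chart_range c)) (snd c)"
    using assms(1) unfolding is_chart_def by (simp add: homeomorphic_imp_open_map)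
  moreover have "openin (subtopology X (chart_dom c)) (chart_dom c \<inter> chart_dom d)"
    using assms unfolding is_chart_def by (simp add: openin_subtopology_Int2)
  ultimately have "openin (top_of_set (chart_range c)) (overlap c d)"
    unfolding open_map_def overlap_def by blast
  then show ?thesis
    using assms(1) unfolding is_chart_def by (simp add: openin_open_eq)
qed

lemma local_expr_transition:
  assumes "is_chart X c" "is_chart X d" "x \<in> overlap c d"
  shows "local_expr f c x = local_expr f d (transition c d x)"
    and "transition c d x \<in> chart_range d"
proof -
  obtain p where p: "p \<in> chart_dom c" "p \<in> chart_dom d" "x = snd c p"
    using assms(3) by (auto simp: overlap_def)
  have "transition c d x = snd d p"
    using p assms by (simp add: transition_def local_expr_chart[OF assms(1)])
  with p show "local_expr f c x = local_expr f d (transition c d x)"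
    and "transition c d x \<in> chart_range d"
    using assms by (simp_all add: local_expr_chart[OF assms(1)] local_expr_chart[OF assms(2)])
qed

lemma pd_compose:
  fixes f :: "real^2 \<Rightarrow> 'b::real_normed_vector" and T :: "real^2 \<Rightarrow> real^2"
  assumes "T differentiable (at x)" "f differentiable (at (T x))"
  shows "pd i (\<lambda>y. f (T y)) x =
    jacobian T (at x) $ 1 $ i *\<^sub>R pd 1 f (T x) + jacobian T (at x) $ 2 $ i *\<^sub>R pd 2 f (T x)"
proof -
  have "frechet_derivative (f \<circ> T) (at x) = frechet_derivative f (at (T x)) \<circ> frechet_derivative T (at x)"
    using assms frechet_derivative_compose by blast
  then have "pd i (\<lambda>y. f (T y)) x = frechet_derivative f (at (T x)) (frechet_derivative T (at x) (axis i 1))"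
    by (simp add: pd_def comp_def fun_eq_iff)
  then show ?thesis
    by (simp add: frechet_derivative_pd[OF assms(2)] jacobian_def matrix_def)
qed

text \<open>A matrix is the sum of its entries times the matrix units, so smoothness follows from
  closure under sums and bounded linear maps.\<close>

lemma smooth_on_matrix:
  fixes M :: "real^2 \<Rightarrow> real^2^2"
  assumes "open U" "\<And>i j. smooth_on (\<lambda>x. M x $ i $ j) U"
  shows "smooth_on M U"
proof -
  let ?E = "\<lambda>i j x. (M x $ i $ j) *\<^sub>R (axis i (axis j 1) :: real^2^2)"
  have "smooth_on (?E i j) U" for i j
    by (rule smooth_on_bounded_linear[OF bounded_linear_scaleR_left assms])
  then have "smooth_on (\<lambda>x. ?E 1 1 x + ?E 1 2 x + ?E 2 1 x + ?E 2 2 x) U"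
    by (intro smooth_on_plus assms(1))
  moreover have "?E 1 1 x + ?E 1 2 x + ?E 2 1 x + ?E 2 2 x = M x" for x
    by (simp add: vec_eq_iff forall_2 axis_def)
  ultimately show ?thesis by simp
qed

lemma second_form_smooth:
  assumes "open U" "smooth_on (local_expr \<psi> c) U" "smooth_on (local_expr N c) U"
  shows "smooth_on (second_form \<epsilon> \<psi> N c) U"
proof (rule smooth_on_matrix[OF assms(1)])
  fix i j
  have "smooth_on (\<lambda>x. amb_inner \<epsilon> (- pd i (local_expr N c) x) (pd j (local_expr \<psi> c) x)) U"
    using assms
    by (intro smooth_on_bilinear[OF bounded_bilinear_amb_inner assms(1)] smooth_on_pd
        smooth_on_bounded_linear[OF bounded_linear_minus[OF bounded_linear_ident] assms(1)])
  then show "smooth_on (\<lambda>x. second_form \<epsilon> \<psi> N c x $ i $ j) U"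
    by (simp add: second_form_def)
qed

text \<open>By the chain rule the partial derivatives of \<psi> and of N transform with the same
  Jacobian, and bilinearity gives the congruence. Both arguments are first derivatives, so the
  Jacobian is never differentiated.\<close>

lemma second_form_transition:
  assumes "is_chart X c" "is_chart X d" "compatible c d" "x \<in> overlap c d"
    and "smooth_on (local_expr \<psi> d) (chart_range d)" "smooth_on (local_expr N d) (chart_range d)"
  shows "second_form \<epsilon> \<psi> N c x = transpose (jacobian (transition c d) (at x)) **
    second_form \<epsilon> \<psi> N d (transition c d x) ** jacobian (transition c d) (at x)"
proof -
  have "open (chart_range d)" using assms(2) by (simp add: is_chart_def)
  have T: "transition c d differentiable (at x)"
    using smooth_on_differentiable[OF _ open_overlap[OF assms(1,2)] assms(4)] assms(3)
    unfolding compatible_def by blast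
  have "pd i (local_expr f c) x =
      jacobian (transition c d) (at x) $ 1 $ i *\<^sub>R pd 1 (local_expr f d) (transition c d x) +
      jacobian (transition c d) (at x) $ 2 $ i *\<^sub>R pd 2 (local_expr f d) (transition c d x)"
    if "smooth_on (local_expr f d) (chart_range d)" for f :: "'a \<Rightarrow> (real^3) \<times> real" and i
  proof -
    have "local_expr f d differentiable (at (transition c d x))"
      using smooth_on_differentiable[OF that \<open>open (chart_range d)\<close>]
        local_expr_transition(2)[OF assms(1,2,4)] .
    note chain = pd_compose[OF T this, of i]
    have "pd i (local_expr f c) x = pd i (\<lambda>y. local_expr f d (transition c d y)) x"
      by (rule pd_eq_on[OF open_overlap[OF assms(1,2)] assms(4)])
        (rule local_expr_transition(1)[OF assms(1,2)])
    then show ?thesis unfolding chain .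
  qed
  note pd = this[OF assms(5)] this[OF assms(6)]
  show ?thesis
    by (simp add: vec_eq_iff forall_2 second_form_def pd matrix_matrix_mult_def transpose_def sum_2
        amb_inner_simps algebra_simps)
qed

lemma immersed_patch_chart:
  assumes "\<epsilon> \<in> {1, -1}" "is_chart X c" "c \<in> \<A>" "immersion \<epsilon> X \<A> \<psi>" "unit_normal \<epsilon> X \<A> \<psi> N"
  shows "immersed_patch \<epsilon> (chart_range c) (local_expr \<psi> c) (local_expr N c)"
proof
  have dom: "chart_dom c \<subseteq> topspace X"
    using assms(2) by (simp add: is_chart_def openin_subset)
  show "\<epsilon> = 1 \<or> \<epsilon> = -1" using assms(1) by auto
  show "open (chart_range c)" using assms(2) by (simp add: is_chart_def)
  show "smooth_on (local_expr \<psi> c) (chart_range c)" "smooth_on (local_expr N c) (chart_range c)"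
    using assms(3,4,5) by (auto simp: immersion_def unit_normal_def smooth_map_def)
  fix x assume x: "x \<in> chart_range c"
  then obtain p where p: "p \<in> chart_dom c" "x = snd c p" by blast
  with dom have pX: "p \<in> topspace X" by blast
  have [simp]: "local_expr \<psi> c x = \<psi> p" "local_expr N c x = N p"
    using p assms(2) by (simp_all add: local_expr_chart)
  have "\<psi> p \<in> M2 \<epsilon> \<times> UNIV"
    using assms(4) pX by (auto simp: immersion_def)
  then show "M2_inner \<epsilon> (fst (local_expr \<psi> c x)) (fst (local_expr \<psi> c x)) = \<epsilon>"
    by (auto simp: M2_def)
  show "inj (frechet_derivative (local_expr \<psi> c) (at x))"
    using assms(3,4) x unfolding immersion_def by blast
  show "M2_inner \<epsilon> (fst (local_expr N c x)) (fst (local_expr \<psi> c x)) = 0"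
    "amb_inner \<epsilon> (local_expr N c x) (local_expr N c x) = 1"
    using assms(5) pX by (simp_all add: unit_normal_def)
  show "amb_inner \<epsilon> (local_expr N c x) (frechet_derivative (local_expr \<psi> c) (at x) v) = 0" for v
    using assms(3,5) x unfolding unit_normal_def by blast
qed

section \<open>From patches to the surface\<close>

theorem theorem1:
  fixes \<epsilon> k :: real
    and X :: "'a topology" and \<A> :: "'a chart set"
    and \<psi> N :: "'a \<Rightarrow> (real^3) \<times> real"
    and A :: "'a form"
  assumes "\<epsilon> \<in> {1, -1}"
    and "smooth_surface X \<A>" and "orientable X \<A>"
    and "immersion \<epsilon> X \<A> \<psi>" and "unit_normal \<epsilon> X \<A> \<psi> N"
    and "constant_gauss_curvature \<A> (first_form \<epsilon> \<psi>) k" and "k \<noteq> \<epsilon>"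
    and "A = (\<lambda>c x. first_form \<epsilon> \<psi> c x
                    + (1 / (\<epsilon> * k - 1)) *\<^sub>R differential_sq (height \<psi>) c x)"
    and "riemannian_metric \<A> A"
  shows "codazzi_pair \<A> A (second_form \<epsilon> \<psi> N) \<and>
         (\<exists>\<kappa>. constant_extrinsic_curvature \<A> A (second_form \<epsilon> \<psi> N) \<kappa>)"
proof -
  have chart: "is_chart X c" and compat: "compatible c d" if "c \<in> \<A>" "d \<in> \<A>" for c d
    using assms(2) that by (auto simp: smooth_surface_def)
  have patch: "immersed_patch \<epsilon> (chart_range c) (local_expr \<psi> c) (local_expr N c)" if "c \<in> \<A>" for c
    using immersed_patch_chart[OF assms(1) chart[OF that that] that assms(4,5)] .
  have B: "second_form \<epsilon> \<psi> N c x $ i $ j = immersed_patch.b \<epsilon> (local_expr \<psi> c) (local_expr N c) i j x"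
    if "c \<in> \<A>" "x \<in> chart_range c" for c x i j
    using immersed_patch.pd_N_P[OF patch[OF that(1)] that(2), of i j]
    by (simp add: second_form_def amb_inner_simps)
  have smooth: "smooth_on (local_expr \<psi> c) (chart_range c)" "smooth_on (local_expr N c) (chart_range c)"
    "open (chart_range c)" if "c \<in> \<A>" for c
    using patch[OF that] by (simp_all add: immersed_patch_def)
  have "quadratic_form \<A> (second_form \<epsilon> \<psi> N)"
    unfolding quadratic_form_def Let_def
  proof (intro conjI ballI)
    fix c assume c: "c \<in> \<A>"
    show "smooth_on (second_form \<epsilon> \<psi> N c) (chart_range c)"
      by (rule second_form_smooth) (use smooth[OF c] in auto)
    show "transpose (second_form \<epsilon> \<psi> N c x) = second_form \<epsilon> \<psi> N c x" if "x \<in> chart_range c" for x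
      using immersed_patch.b_sym[OF patch[OF c] that]
      by (simp add: vec_eq_iff transpose_def B[OF c that])
    show "second_form \<epsilon> \<psi> N c x = transpose (jacobian (transition c d) (at x)) **
        second_form \<epsilon> \<psi> N d (transition c d x) ** jacobian (transition c d) (at x)"
      if "d \<in> \<A>" "x \<in> overlap c d" for d x
      by (rule second_form_transition[OF chart[OF c c] chart[OF that(1) that(1)]
          compat[OF c that(1)] that(2) smooth(1,2)[OF that(1)]])
  qed
  \<comment> \<open>The constant k - \<epsilon> is the ratio of determinants in
    \<open>det_b\<close>; it is the same in every chart.\<close>
  moreover have "codazzi_equations (A c) (second_form \<epsilon> \<psi> N c) x \<and>
      extrinsic_curvature (A c) (second_form \<epsilon> \<psi> N c) x = k - \<epsilon>"
    if c: "c \<in> \<A>" and x: "x \<in> chart_range c" for c x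
  proof -
    interpret immersed_patch \<epsilon> "chart_range c" "local_expr \<psi> c" "local_expr N c"
      using patch[OF c] .
    have m: "first_form \<epsilon> \<psi> c = metric"
      by (simp add: fun_eq_iff first_form_def metric_def g_def)
    interpret immersed_patch_constant_curvature \<epsilon> "chart_range c" "local_expr \<psi> c" "local_expr N c" k
      by unfold_locales (use assms(6,7) c m in \<open>auto simp: constant_gauss_curvature_def\<close>)
    let ?A = "immersed_patch_constant_curvature.A \<epsilon> (local_expr \<psi> c) k"
    \<comment> \<open>The differential of the height is the vertical component of the differential
      of \<psi>, which identifies the form of the theorem with the metric of the patch.\<close>
    have "local_expr (height \<psi>) c = (\<lambda>y. snd (local_expr \<psi> c y))"
      by (simp add: fun_eq_iff local_expr_def height_def)
    then have "pd i (local_expr (height \<psi>) c) y = h i y" if "y \<in> chart_range c" for i y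
      using pd_bounded_linear[OF bounded_linear_snd differentiable(1)[OF that]] by simp
    then have Ac: "A c y = ?A y"
      if "y \<in> chart_range c" for y
      using that by (simp add: assms(8) vec_eq_iff m metric_component differential_sq_def
          A_component a_def c_def)
    \<comment> \<open>Positivity of A enters the local computation through this
      nonvanishing.\<close>
    have "det (A c x) \<noteq> 0"
      using assms(9) c x by (intro det_pos_definite_nz) (auto simp: riemannian_metric_def)
    then have det: "det (?A x) \<noteq> 0" using Ac[OF x] by simp
    have "codazzi_equations (A c) (second_form \<epsilon> \<psi> N c) x"
      by (rule codazzi_equations_eq_on[OF open_U x Ac codazzi_A[OF x det B[OF c]]])
    moreover have "extrinsic_curvature (A c) (second_form \<epsilon> \<psi> N c) x = k - \<epsilon>"
      using extrinsic_curvature_A[OF x det B[OF c]] Ac[OF x] by (simp add: extrinsic_curvature_def)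
    ultimately show ?thesis ..
  qed
  ultimately show ?thesis
    using assms(9) by (auto simp: codazzi_pair_def constant_extrinsic_curvature_def)
qed

end
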